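(* Let $W$ be the $2|1$-dimensional complex $\mathbb Z_2$-graded vector space with basis $w_1$ (odd), $w_2,w_3$ (even). Every nonzero codifferential of degree $2$ of the first kind on $W$, i.e. every nonzero $$d=\psi^{1,1,0}_2x+\psi^{1,1,0}_3a+\psi^{1,0,1}_2b+\psi^{1,0,1}_3c',\qquad x,a,b,c'\in\mathbb C,$$ is equivalent to one of the following codifferentials: $$d_*=\psi^{1,1,0}_3,\qquad d_\sharp=\psi^{1,1,0}_2+\psi^{1,1,0}_3+\psi^{1,0,1}_3,\qquad d_c=\psi^{1,1,0}_2+\psi^{1,0,1}_3c\quad(c\in\mathbb C).$$ Moreover, $d_*$, $d_\sharp$ and the $d_c$ are pairwise inequivalent, except that for $c\neq c'$ the codifferentials $d_c$ and $d_{c'}$ are equivalent precisely when $cc'=1$ (that is, $d_c\sim d_{c'}$ if and only if $c'=c^{\pm1}$).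
   Context: All spaces are $\mathbb Z_2$-graded over $\mathbb C$. $S(W)=\bigoplus_{n\ge1}S^n(W)$ is the symmetric coalgebra of $W$ (so $w_1^2=0$). $L_n=\mathrm{Hom}(S^n(W),W)$, and $L=\prod_{n\ge1}L_n$ is identified with the coderivations of $S(W)$; it is a $\mathbb Z_2$-graded Lie algebra under the graded commutator. A codifferential is an odd $d\in L$ with $[d,d]=0$; it has degree $n$ if $d\in L_n$. For a multi-index $I=(i_1,i_2,i_3)$ with $i_1\in\{0,1\}$, $i_2,i_3\ge0$, put $w_I=w_1^{i_1}w_2^{i_2}w_3^{i_3}$, $I!=i_1!i_2!i_3!$, and let $\varphi^I_j\in\mathrm{Hom}(S^{|I|}(W),W)$ be given by $\varphi^I_j(w_J)=I!\,\delta^I_J\,w_j$; when this element is odd it is written $\psi^I_j$. Every combination of the $\psi^{1,q,1-q}_2,\psi^{1,q,1-q}_3$ ($q=0,1$) is a codifferential. Two codifferentials $d,d'$ are equivalent ($d\sim d'$) if $d'=g^{-1}dg$ for some (even) coalgebra automorphism $g$ of $S(W)$, i.e. one determined by an even $g=g_1+g_2+\cdots\in\mathrm{Hom}(S(W),W)$ with $g_1:W\to W$ invertible. *)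

theory Defs
  imports Complex_Main "HOL-Library.Poly_Mapping" "HOL-Library.Product_Plus"
begin

text \<open>
  The space \<open>W\<close> has the basis \<open>w 1\<close> (odd), \<open>w 2\<close>, \<open>w 3\<close> (even).
  The symmetric coalgebra \<open>S(W)\<close>, without its degree \<open>0\<close> part, has the basis of monomials
  \<open>w_I\<close>, where \<open>I\<close> runs over the multi-indices below: \<open>w_1\<^sup>2 = 0\<close> forces \<open>i1 \<le> 1\<close>.
  A vector is a finitely supported coefficient function.
\<close>

typedef midx = "{(i1 :: nat, i2 :: nat, i3 :: nat). i1 \<le> 1 \<and> (i1, i2, i3) \<noteq> (0, 0, 0)}"
  morphisms expo Midx
  by (rule exI[of _ "(1, 0, 0)"]) simp

type_synonym SW = "midx \<Rightarrow>\<^sub>0 complex"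
type_synonym SW2 = "midx \<times> midx \<Rightarrow>\<^sub>0 complex"  \<comment> \<open>\<open>S(W) \<otimes> S(W)\<close>\<close>

definition scale :: "complex \<Rightarrow> ('a \<Rightarrow>\<^sub>0 complex) \<Rightarrow> ('a \<Rightarrow>\<^sub>0 complex)" (infixr "*\<^sub>C" 75)
  where "c *\<^sub>C v = Poly_Mapping.map ((*) c) v"

lemma lookup_scale [simp]: "Poly_Mapping.lookup (c *\<^sub>C v) i = c * Poly_Mapping.lookup v i"
  unfolding scale_def by transfer (simp add: when_def)

global_interpretation poly_mapping: vector_space scale
  by unfold_locales (auto intro!: poly_mapping_eqI simp: lookup_add algebra_simps)

abbreviation clinear :: "(('a \<Rightarrow>\<^sub>0 complex) \<Rightarrow> ('b \<Rightarrow>\<^sub>0 complex)) \<Rightarrow> bool"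
  where "clinear \<equiv> Vector_Spaces.linear scale scale"

text \<open>The linear map with prescribed values on the basis.\<close>

definition extend :: "('a \<Rightarrow> ('b \<Rightarrow>\<^sub>0 complex)) \<Rightarrow> ('a \<Rightarrow>\<^sub>0 complex) \<Rightarrow> ('b \<Rightarrow>\<^sub>0 complex)"
  where "extend F v = (\<Sum>i\<in>Poly_Mapping.keys v. Poly_Mapping.lookup v i *\<^sub>C F i)"

definition tensor :: "('a \<Rightarrow>\<^sub>0 complex) \<Rightarrow> ('b \<Rightarrow>\<^sub>0 complex) \<Rightarrow> ('a \<times> 'b \<Rightarrow>\<^sub>0 complex)"
  where "tensor u v = (\<Sum>i\<in>Poly_Mapping.keys u. \<Sum>j\<in>Poly_Mapping.keys v. Poly_Mapping.single (i, j) (Poly_Mapping.lookup u i * Poly_Mapping.lookup v j))"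

subsection \<open>Monomials and grading\<close>

definition parity :: "midx \<Rightarrow> nat"
  where "parity I = fst (expo I)"

fun size3 :: "nat \<times> nat \<times> nat \<Rightarrow> nat"
  where "size3 (i1, i2, i3) = i1 + i2 + i3"

fun fact3 :: "nat \<times> nat \<times> nat \<Rightarrow> nat"
  where "fact3 (i1, i2, i3) = fact i1 * fact i2 * fact i3"

fun choose3 :: "nat \<times> nat \<times> nat \<Rightarrow> nat \<times> nat \<times> nat \<Rightarrow> nat"
  where "choose3 (i1, i2, i3) (j1, j2, j3) = (i1 choose j1) * (i2 choose j2) * (i3 choose j3)"

text \<open>
  \<open>mon i\<close> is \<open>w_1^i1 w_2^i2 w_3^i3\<close>. It is \<open>0\<close> if \<open>i1 \<ge> 2\<close>, and also for \<open>i = (0, 0, 0)\<close>,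
  as \<open>S(W)\<close> has no unit here.
\<close>

definition mon :: "nat \<times> nat \<times> nat \<Rightarrow> SW"
  where "mon i = (if i \<in> range expo then Poly_Mapping.single (Midx i) 1 else 0)"

abbreviation basis :: "midx \<Rightarrow> SW"
  where "basis I \<equiv> Poly_Mapping.single I 1"

fun unit3 :: "nat \<Rightarrow> nat \<times> nat \<times> nat"
  where "unit3 j = (of_bool (j = 1), of_bool (j = 2), of_bool (j = 3))"

definition w :: "nat \<Rightarrow> SW"
  where "w j = mon (unit3 j)"

definition W :: "SW set"
  where "W = {v. \<forall>I\<in>Poly_Mapping.keys v. size3 (expo I) = 1}"

definition to_W :: "SW \<Rightarrow> SW"
  where "to_W = extend (\<lambda>I. if size3 (expo I) = 1 then basis I else 0)"

text \<open>Parities are natural numbers read modulo \<open>2\<close>.\<close>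

definition graded_part :: "nat \<Rightarrow> SW set"
  where "graded_part p = {v. \<forall>I\<in>Poly_Mapping.keys v. even (parity I + p)}"

definition homogeneous_map :: "nat \<Rightarrow> (SW \<Rightarrow> SW) \<Rightarrow> bool"
  where "homogeneous_map p f \<longleftrightarrow> (\<forall>q. f ` graded_part q \<subseteq> graded_part (q + p))"

subsection \<open>Coalgebra structure, coderivations and automorphisms\<close>

definition splits :: "midx \<Rightarrow> (midx \<times> midx) set"
  where "splits I = {(J, K). expo J + expo K = expo I}"

text \<open>
  The coproduct sums \<open>\<epsilon>(\<sigma>) w_\<sigma>(1) \<cdots> w_\<sigma>(k) \<otimes> w_\<sigma>(k+1) \<cdots> w_\<sigma>(n)\<close> over the \<open>(k, n - k)\<close>-shuffles
  \<open>\<sigma>\<close>, \<open>0 < k < n\<close>. As \<open>w_1\<close> is the only odd basis vector and occurs at most once, all Koszul signs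
  \<open>\<epsilon>(\<sigma>)\<close> are \<open>1\<close>. For the same reason no signs occur in the product of monomials.
\<close>

definition coproduct :: "SW \<Rightarrow> SW2"
  where "coproduct = extend (\<lambda>I. \<Sum>(J, K)\<in>splits I.
           of_nat (choose3 (expo I) (expo J)) *\<^sub>C tensor (basis J) (basis K))"

definition product :: "SW2 \<Rightarrow> SW"
  where "product = extend (\<lambda>(J, K). mon (expo J + expo K))"

text \<open>
  \<open>tensor_map q f g\<close> is \<open>f \<otimes> g\<close> for \<open>g\<close> homogeneous of parity \<open>q\<close>:
  \<open>(f \<otimes> g)(u \<otimes> v) = (-1)^(q \<bar>u\<bar>) f u \<otimes> g v\<close>.
\<close>

definition tensor_map :: "nat \<Rightarrow> (SW \<Rightarrow> SW) \<Rightarrow> (SW \<Rightarrow> SW) \<Rightarrow> SW2 \<Rightarrow> SW2"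
  where "tensor_map q f g = extend (\<lambda>(I, J).
           (- 1) ^ (q * parity I) *\<^sub>C tensor (f (basis I)) (g (basis J)))"

definition coderivation :: "nat \<Rightarrow> (SW \<Rightarrow> SW) \<Rightarrow> bool"
  where "coderivation p D \<longleftrightarrow> clinear D \<and> homogeneous_map p D \<and>
           (\<forall>v. coproduct (D v) =
              tensor_map 0 D id (coproduct v) + tensor_map p id D (coproduct v))"

definition coalgebra_automorphism :: "(SW \<Rightarrow> SW) \<Rightarrow> bool"
  where "coalgebra_automorphism g \<longleftrightarrow> clinear g \<and> bij g \<and> homogeneous_map 0 g \<and>
           (\<forall>v. coproduct (g v) = tensor_map 0 g g (coproduct v))"

subsection \<open>The Lie algebra \<open>L\<close> and codifferentials\<close>

text \<open>\<open>L = \<Prod>n\<ge>1. Hom(S^n(W), W) = Hom(S(W), W)\<close>, with \<open>W = S^1(W)\<close> inside \<open>S(W)\<close>.\<close>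

definition L :: "(SW \<Rightarrow> SW) set"
  where "L = {m. clinear m \<and> range m \<subseteq> W}"

text \<open>
  The coderivation identified with \<open>m \<in> L\<close>:
  \<open>w_1 \<cdots> w_n \<mapsto> \<Sum>k=1..n. \<Sum>\<sigma>. \<epsilon>(\<sigma>) m(w_\<sigma>(1) \<cdots> w_\<sigma>(k)) w_\<sigma>(k+1) \<cdots> w_\<sigma>(n)\<close> over
  \<open>(k, n - k)\<close>-shuffles \<open>\<sigma>\<close>; the summand \<open>m v\<close> is the case \<open>k = n\<close>.
  It is the unique coderivation with component \<open>m\<close> in \<open>W\<close>; see \<open>coder_coderivation\<close>,
  \<open>to_W_coder\<close> and \<open>coderivation_eq_coder\<close> below.
\<close>

definition coder :: "(SW \<Rightarrow> SW) \<Rightarrow> (SW \<Rightarrow> SW)"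
  where "coder m v = m v + product (tensor_map 0 m id (coproduct v))"

definition gcommutator :: "nat \<Rightarrow> nat \<Rightarrow> (SW \<Rightarrow> SW) \<Rightarrow> (SW \<Rightarrow> SW) \<Rightarrow> (SW \<Rightarrow> SW)"
  where "gcommutator p q D E = (\<lambda>v. D (E v) - (- 1) ^ (p * q) *\<^sub>C E (D v))"

definition codifferential :: "(SW \<Rightarrow> SW) \<Rightarrow> bool"
  where "codifferential d \<longleftrightarrow> d \<in> L \<and> homogeneous_map 1 d \<and>
           gcommutator 1 1 (coder d) (coder d) = (\<lambda>v. 0)"

definition equivalent :: "(SW \<Rightarrow> SW) \<Rightarrow> (SW \<Rightarrow> SW) \<Rightarrow> bool" (infix "\<approx>" 50)
  where "d \<approx> d' \<longleftrightarrow> codifferential d \<and> codifferential d' \<and>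
           (\<exists>g. coalgebra_automorphism g \<and> coder d' = inv g \<circ> coder d \<circ> g)"

definition phi :: "nat \<times> nat \<times> nat \<Rightarrow> nat \<Rightarrow> SW \<Rightarrow> SW"
  where "phi I j = extend (\<lambda>J. if expo J = I then of_nat (fact3 I) *\<^sub>C w j else 0)"

text \<open>The name \<open>psi\<close> signals that the element is odd.\<close>

abbreviation psi :: "nat \<times> nat \<times> nat \<Rightarrow> nat \<Rightarrow> SW \<Rightarrow> SW"
  where "psi \<equiv> phi"

definition first_kind :: "complex \<Rightarrow> complex \<Rightarrow> complex \<Rightarrow> complex \<Rightarrow> SW \<Rightarrow> SW"
  where "first_kind x a b c = (\<lambda>v. x *\<^sub>C psi (1,1,0) 2 v + a *\<^sub>C psi (1,1,0) 3 v
           + b *\<^sub>C psi (1,0,1) 2 v + c *\<^sub>C psi (1,0,1) 3 v)"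

definition d_star :: "SW \<Rightarrow> SW"
  where "d_star = psi (1,1,0) 3"

definition d_sharp :: "SW \<Rightarrow> SW"
  where "d_sharp = (\<lambda>v. psi (1,1,0) 2 v + psi (1,1,0) 3 v + psi (1,0,1) 3 v)"

definition d_c :: "complex \<Rightarrow> SW \<Rightarrow> SW"
  where "d_c c = (\<lambda>v. psi (1,1,0) 2 v + c *\<^sub>C psi (1,0,1) 3 v)"

subsection \<open>Linear maps on a basis\<close>

lemma extend_superset:
  assumes "finite A" "Poly_Mapping.keys v \<subseteq> A"
  shows "extend F v = (\<Sum>i\<in>A. Poly_Mapping.lookup v i *\<^sub>C F i)"
  unfolding extend_def
  by (rule sum.mono_neutral_left) (use assms in \<open>auto simp: in_keys_iff\<close>)

lemma clinear_iff:
  "clinear f \<longleftrightarrow> (\<forall>u v. f (u + v) = f u + f v) \<and> (\<forall>c v. f (c *\<^sub>C v) = c *\<^sub>C f v)"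
  by (simp add: Vector_Spaces.linear_iff poly_mapping.vector_space_axioms)

lemma clinear_extend: "clinear (extend F)"
  unfolding clinear_iff
proof (intro conjI allI)
  fix u v :: "'a \<Rightarrow>\<^sub>0 complex"
  let ?A = "Poly_Mapping.keys u \<union> Poly_Mapping.keys v"
  have "extend F (u + v) = (\<Sum>i\<in>?A. Poly_Mapping.lookup (u + v) i *\<^sub>C F i)"
    by (rule extend_superset) (use Poly_Mapping.keys_add[of u v] in auto)
  also have "\<dots> = extend F u + extend F v"
    by (simp add: extend_superset[of ?A] lookup_add poly_mapping.scale_left_distrib sum.distrib)
  finally show "extend F (u + v) = extend F u + extend F v" .
next
  fix c and v :: "'a \<Rightarrow>\<^sub>0 complex"
  have "extend F (c *\<^sub>C v) = (\<Sum>i\<in>Poly_Mapping.keys v. Poly_Mapping.lookup (c *\<^sub>C v) i *\<^sub>C F i)"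
    by (rule extend_superset) (auto simp: in_keys_iff)
  thus "extend F (c *\<^sub>C v) = c *\<^sub>C extend F v"
    by (simp add: extend_def poly_mapping.scale_sum_right)
qed

lemma extend_single [simp]: "extend F (Poly_Mapping.single i c) = c *\<^sub>C F i"
  by (subst extend_superset[of "{i}"]) auto

lemma extend_basis: "extend (\<lambda>i. Poly_Mapping.single i 1) v = v"
proof (rule poly_mapping_eqI)
  fix k
  have "Poly_Mapping.lookup (extend (\<lambda>i. Poly_Mapping.single i 1) v) k
      = (\<Sum>i\<in>Poly_Mapping.keys v. if i = k then Poly_Mapping.lookup v k else 0)"
    unfolding extend_def lookup_sum by (rule sum.cong) (auto simp: lookup_single when_def)
  also have "\<dots> = Poly_Mapping.lookup v k"
    by (simp add: in_keys_iff)
  finally show "Poly_Mapping.lookup (extend (\<lambda>i. Poly_Mapping.single i 1) v) k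
      = Poly_Mapping.lookup v k" .
qed

lemma clinear_zero: assumes "clinear f" shows "f 0 = 0"
  using assms unfolding clinear_iff by (metis add_cancel_left_right)

lemma clinear_sum: "clinear f \<Longrightarrow> f (sum h A) = (\<Sum>i\<in>A. f (h i))"
  by (induction A rule: infinite_finite_induct) (auto simp: clinear_zero, auto simp: clinear_iff)

lemma clinear_eq_extend:
  assumes "clinear f"
  shows "f v = extend (\<lambda>i. f (Poly_Mapping.single i 1)) v"
proof -
  have "f v = f (extend (\<lambda>i. Poly_Mapping.single i 1) v)" by (simp add: extend_basis)
  also have "\<dots> = extend (\<lambda>i. f (Poly_Mapping.single i 1)) v"
    unfolding extend_def using assms by (simp add: clinear_sum[OF assms] clinear_iff)
  finally show ?thesis .
qed

lemma clinear_eqI: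
  assumes "clinear f" "clinear g" "\<And>i. f (Poly_Mapping.single i 1) = g (Poly_Mapping.single i 1)"
  shows "f v = g v"
  by (subst clinear_eq_extend[OF assms(1)], subst clinear_eq_extend[OF assms(2)]) (simp add: assms(3))

lemma clinear_plus: "clinear f \<Longrightarrow> clinear g \<Longrightarrow> clinear (\<lambda>v. f v + g v)"
  by (simp add: clinear_iff poly_mapping.scale_right_distrib add_ac)

lemma clinear_comp: "clinear f \<Longrightarrow> clinear g \<Longrightarrow> clinear (\<lambda>v. f (g v))"
  by (simp add: clinear_iff)

lemma lookup_tensor [simp]:
  "Poly_Mapping.lookup (tensor u v) (i, j) = Poly_Mapping.lookup u i * Poly_Mapping.lookup v j"
proof -
  have "Poly_Mapping.lookup (tensor u v) (i, j)
      = (\<Sum>a\<in>Poly_Mapping.keys u. if a = i then (\<Sum>b\<in>Poly_Mapping.keys v.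
           if b = j then Poly_Mapping.lookup u i * Poly_Mapping.lookup v j else 0) else 0)"
    unfolding tensor_def lookup_sum
    by (rule sum.cong) (auto simp: lookup_single when_def intro!: sum.cong sum.neutral)
  also have "\<dots> = Poly_Mapping.lookup u i * Poly_Mapping.lookup v j"
    by (auto simp: in_keys_iff)
  finally show ?thesis .
qed

lemma lookup_extend:
  "Poly_Mapping.lookup (extend F v) k
    = (\<Sum>i\<in>Poly_Mapping.keys v. Poly_Mapping.lookup v i * Poly_Mapping.lookup (F i) k)"
  by (simp add: extend_def lookup_sum)

subsection \<open>Coderivations and \<open>L\<close>\<close>

lemma expo_mem: "fst (expo I) \<le> 1" "expo I \<noteq> (0, 0, 0)"
  using expo[of I] by auto

lemma range_expo: "range expo = {(i1, i2, i3). i1 \<le> 1 \<and> (i1, i2, i3) \<noteq> (0, 0, 0)}"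
  by (rule type_definition.Rep_range[OF type_definition_midx])

lemma expo_Midx: "i \<in> range expo \<Longrightarrow> expo (Midx i) = i"
  by (auto simp: expo_inverse)

lemma expo_eq_iff [simp]: "expo I = expo J \<longleftrightarrow> I = J"
  by (rule expo_inject)

lemma lookup_mon: "Poly_Mapping.lookup (mon n) M = of_bool (expo M = n)"
  by (auto simp: mon_def lookup_single when_def expo_inverse expo_Midx) (metis rangeI)

lemma finite_below: "finite {J. choose3 (expo I) (expo J) \<noteq> 0}"
proof -
  obtain a b c where I: "expo I = (a, b, c)" by (cases "expo I") auto
  have "{J. choose3 (expo I) (expo J) \<noteq> 0} \<subseteq> Midx ` ({..a} \<times> {..b} \<times> {..c})"
  proof
    fix J assume "J \<in> {J. choose3 (expo I) (expo J) \<noteq> 0}"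
    hence "expo J \<in> {..a} \<times> {..b} \<times> {..c}"
      by (cases "expo J") (auto simp: I)
    thus "J \<in> Midx ` ({..a} \<times> {..b} \<times> {..c})"
      using expo_inverse[of J] by (metis imageI)
  qed
  thus ?thesis by (rule finite_subset) auto
qed

lemma splits_below:
  assumes "(J, K) \<in> splits I"
  shows "choose3 (expo I) (expo J) \<noteq> 0" "choose3 (expo I) (expo K) \<noteq> 0"
  using assms by (cases "expo I"; cases "expo J"; cases "expo K"; auto simp: splits_def)+

lemma finite_splits [simp]: "finite (splits I)"
proof (rule finite_subset)
  let ?B = "{J. choose3 (expo I) (expo J) \<noteq> 0}"
  show "splits I \<subseteq> ?B \<times> ?B" using splits_below by auto
  show "finite (?B \<times> ?B)" by (intro finite_cartesian_product finite_below)
qed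

lemma sum_splits_fst:
  "(\<Sum>(J, K)\<in>splits I. if J = A then h J K else 0)
    = (if \<exists>K. expo A + expo K = expo I then h A (Midx (expo I - expo A)) else (0::'a::comm_monoid_add))"
proof (cases "\<exists>K. expo A + expo K = expo I")
  case True
  then obtain K0 where K0: "expo A + expo K0 = expo I" by blast
  hence M: "Midx (expo I - expo A) = K0" by (metis add_diff_cancel_left' expo_inverse)
  have "(\<Sum>(J, K)\<in>splits I. if J = A then h J K else 0)
      = (\<Sum>p\<in>splits I. if p = (A, K0) then h A K0 else 0)"
  proof (rule sum.cong[OF refl], clarify)
    fix J K assume "(J, K) \<in> splits I"
    thus "(if J = A then h J K else 0) = (if (J, K) = (A, K0) then h A K0 else 0)"
      using K0 by (auto simp: splits_def) (metis add_left_cancel expo_inject)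
  qed
  also have "\<dots> = h A K0" using K0 by (subst sum.delta) (simp_all, simp add: splits_def)
  finally show ?thesis using True by (simp add: M)
next
  case False
  thus ?thesis by (auto simp: splits_def intro!: sum.neutral)
qed

lemma sum_splits_snd:
  "(\<Sum>(J, K)\<in>splits I. if K = B then h J K else 0)
    = (if \<exists>J. expo J + expo B = expo I then h (Midx (expo I - expo B)) B else (0::'a::comm_monoid_add))"
proof -
  have "(\<Sum>(J, K)\<in>splits I. if K = B then h J K else 0)
      = (\<Sum>(J, K)\<in>splits I. if J = B then h K J else 0)"
    by (rule sum.reindex_bij_witness[of _ prod.swap prod.swap]) (auto simp: splits_def add_ac)
  thus ?thesis by (simp add: sum_splits_fst add_ac)
qed

lemma coproduct_basis: "coproduct (basis I) =
    (\<Sum>(J, K)\<in>splits I. of_nat (choose3 (expo I) (expo J)) *\<^sub>C Poly_Mapping.single (J, K) 1)"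
proof -
  have "tensor (basis J) (basis K) = Poly_Mapping.single (J, K) 1" for J K
    by (simp add: tensor_def)
  thus ?thesis by (simp add: coproduct_def)
qed

lemma clinear_tensor_map: "clinear (tensor_map q f g)"
  and clinear_coproduct: "clinear coproduct"
  and clinear_product: "clinear product"
  and clinear_to_W: "clinear to_W"
  unfolding tensor_map_def coproduct_def product_def to_W_def by (rule clinear_extend)+

lemma lookup_coproduct_basis:
  "Poly_Mapping.lookup (coproduct (basis I)) (A, B)
    = (if expo A + expo B = expo I then of_nat (choose3 (expo I) (expo A)) else 0)"
proof -
  have "Poly_Mapping.lookup (coproduct (basis I)) (A, B)
      = (\<Sum>p\<in>splits I. if p = (A, B) then of_nat (choose3 (expo I) (expo A)) else 0)"
    unfolding coproduct_basis lookup_sum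
    by (rule sum.cong) (auto simp: lookup_single when_def split: if_splits)
  also have "\<dots> = (if (A, B) \<in> splits I then of_nat (choose3 (expo I) (expo A)) else 0)"
    by simp
  finally show ?thesis by (simp add: splits_def)
qed

lemma lookup_coproduct:
  "Poly_Mapping.lookup (coproduct v) (A, B)
    = (if expo A + expo B \<in> range expo
       then of_nat (choose3 (expo A + expo B) (expo A)) * Poly_Mapping.lookup v (Midx (expo A + expo B))
       else 0)"
proof -
  have "Poly_Mapping.lookup (coproduct v) (A, B) = (\<Sum>I\<in>Poly_Mapping.keys v.
      Poly_Mapping.lookup v I * Poly_Mapping.lookup (coproduct (basis I)) (A, B))"
    by (subst clinear_eq_extend[OF clinear_coproduct]) (simp add: lookup_extend)
  also have "\<dots> = (\<Sum>I\<in>Poly_Mapping.keys v. if I = Midx (expo A + expo B) then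
      (if expo A + expo B \<in> range expo
       then of_nat (choose3 (expo A + expo B) (expo A)) * Poly_Mapping.lookup v (Midx (expo A + expo B))
       else 0) else 0)"
    by (rule sum.cong) (auto simp: lookup_coproduct_basis expo_Midx expo_inverse)
  finally show ?thesis by (auto simp: in_keys_iff)
qed

lemma lookup_tensor_map_coproduct:
  "Poly_Mapping.lookup (tensor_map q f g (coproduct (basis I))) (A, B)
    = (\<Sum>(J, K)\<in>splits I. of_nat (choose3 (expo I) (expo J)) * (- 1) ^ (q * parity J)
        * Poly_Mapping.lookup (f (basis J)) A * Poly_Mapping.lookup (g (basis K)) B)"
proof -
  have "tensor_map q f g (coproduct (basis I)) =
     (\<Sum>(J, K)\<in>splits I. of_nat (choose3 (expo I) (expo J)) *\<^sub>C
        (- 1) ^ (q * parity J) *\<^sub>C tensor (f (basis J)) (g (basis K)))"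
    unfolding coproduct_basis clinear_sum[OF clinear_tensor_map]
    by (rule sum.cong) (use clinear_tensor_map[of q f g] in \<open>auto simp: clinear_iff tensor_map_def\<close>)
  thus ?thesis
    by (auto simp: lookup_sum mult.assoc intro!: sum.cong)
qed

lemma parity_unit: "fst (unit3 j) = of_bool (j = 1)"
  by simp

lemma in_W_iff: "v \<in> W \<longleftrightarrow> (\<forall>I. size3 (expo I) \<noteq> 1 \<longrightarrow> Poly_Mapping.lookup v I = 0)"
  by (auto simp: W_def in_keys_iff)

lemma size3_1: "size3 i = 1 \<longleftrightarrow> (\<exists>j\<in>{1,2,3}. i = unit3 j)"
  by (cases i) auto

lemma unit3_range: "j \<in> {1,2,3} \<Longrightarrow> unit3 j \<in> range expo"
  unfolding range_expo by auto

lemma unit3_inj: "j \<in> {1,2,3} \<Longrightarrow> k \<in> {1,2,3} \<Longrightarrow> unit3 j = unit3 k \<longleftrightarrow> j = k"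
  by auto

lemma W_expand:
  assumes "v \<in> W"
  shows "v = (\<Sum>j\<in>{1,2,3}. Poly_Mapping.lookup v (Midx (unit3 j)) *\<^sub>C w j)"
proof (rule poly_mapping_eqI)
  fix M
  show "Poly_Mapping.lookup v M = Poly_Mapping.lookup (\<Sum>j\<in>{1,2,3}. Poly_Mapping.lookup v (Midx (unit3 j)) *\<^sub>C w j) M"
  proof (cases "size3 (expo M) = 1")
    case True
    then obtain k where k: "k \<in> {1,2,3}" "expo M = unit3 k" using size3_1[of "expo M"] by blast
    have "Poly_Mapping.lookup (\<Sum>j\<in>{1,2,3}. Poly_Mapping.lookup v (Midx (unit3 j)) *\<^sub>C w j) M
       = (\<Sum>j\<in>{1,2,3}. if j = k then Poly_Mapping.lookup v (Midx (unit3 j)) else 0)"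
      unfolding lookup_sum
    proof (rule sum.cong[OF refl])
      fix j assume j: "j \<in> {1, 2, 3::nat}"
      have "expo M = unit3 j \<longleftrightarrow> j = k" unfolding k(2) using unit3_inj[OF k(1) j] by blast
      thus "Poly_Mapping.lookup (Poly_Mapping.lookup v (Midx (unit3 j)) *\<^sub>C w j) M
          = (if j = k then Poly_Mapping.lookup v (Midx (unit3 j)) else 0)"
        by (simp add: w_def lookup_mon del: unit3.simps)
    qed
    also have "\<dots> = Poly_Mapping.lookup v (Midx (unit3 k))" using k(1) by simp
    also have "\<dots> = Poly_Mapping.lookup v M" using k(2) by (metis expo_inverse)
    finally show ?thesis by simp
  next
    case False
    hence "expo M \<noteq> unit3 j" if "j \<in> {1,2,3}" for j using that size3_1 by blast
    thus ?thesis using assms False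
      by (simp add: lookup_add w_def lookup_mon in_W_iff del: unit3.simps)
  qed
qed

text \<open>
  The matrix entry at \<open>(I, M)\<close> of the coderivation of the element of \<open>L\<close> that sends \<open>w_P\<close> to \<open>w j\<close>
  and all other monomials to \<open>0\<close>.
\<close>

definition elem :: "midx \<Rightarrow> nat \<Rightarrow> midx \<Rightarrow> midx \<Rightarrow> complex"
  where "elem P j I M = (if expo M + expo P = expo I + unit3 j then of_nat (choose3 (expo I) (expo P)) else 0)"

lemma coder_basis:
  assumes "m \<in> L"
  shows "Poly_Mapping.lookup (coder m (basis I)) M =
    Poly_Mapping.lookup (m (basis I)) M +
    (\<Sum>(J, K)\<in>splits I. of_nat (choose3 (expo I) (expo J)) *
      (\<Sum>j\<in>{1,2,3}. Poly_Mapping.lookup (m (basis J)) (Midx (unit3 j)) * of_bool (expo M = unit3 j + expo K)))"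
proof -
  have m: "clinear m" "m v \<in> W" for v using assms by (auto simp: L_def)
  have t: "product (tensor (m (basis J)) (basis K)) =
     (\<Sum>j\<in>{1,2,3}. Poly_Mapping.lookup (m (basis J)) (Midx (unit3 j)) *\<^sub>C mon (unit3 j + expo K))" for J K
  proof -
    have "tensor (m (basis J)) (basis K) =
     (\<Sum>j\<in>{1,2,3}. Poly_Mapping.lookup (m (basis J)) (Midx (unit3 j)) *\<^sub>C Poly_Mapping.single (Midx (unit3 j), K) 1)"
    proof (rule poly_mapping_eqI, clarify)
      fix A B
      have "Poly_Mapping.lookup (m (basis J)) A = Poly_Mapping.lookup
          (\<Sum>j\<in>{1,2,3}. Poly_Mapping.lookup (m (basis J)) (Midx (unit3 j)) *\<^sub>C w j) A"
        by (subst W_expand[OF m(2)]) simp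
      thus "Poly_Mapping.lookup (tensor (m (basis J)) (basis K)) (A, B) = Poly_Mapping.lookup
         (\<Sum>j\<in>{1,2,3}. Poly_Mapping.lookup (m (basis J)) (Midx (unit3 j)) *\<^sub>C Poly_Mapping.single (Midx (unit3 j), K) 1) (A, B)"
        unfolding lookup_tensor
        apply (simp only: lookup_sum sum_distrib_right)
        apply (rule sum.cong[OF refl])
        using unit3_range by (auto simp: w_def mon_def lookup_single when_def simp del: unit3.simps)
    qed
    also have "product \<dots> = (\<Sum>j\<in>{1,2,3}. Poly_Mapping.lookup (m (basis J)) (Midx (unit3 j)) *\<^sub>C mon (unit3 j + expo K))"
      unfolding clinear_sum[OF clinear_product]
      by (rule sum.cong) (use clinear_product unit3_range in \<open>auto simp: clinear_iff product_def expo_Midx simp del: unit3.simps\<close>)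
    finally show ?thesis .
  qed
  have "product (tensor_map 0 m id (coproduct (basis I))) =
    (\<Sum>(J, K)\<in>splits I. of_nat (choose3 (expo I) (expo J)) *\<^sub>C product (tensor (m (basis J)) (basis K)))"
    unfolding coproduct_basis clinear_sum[OF clinear_tensor_map] clinear_sum[OF clinear_product]
    by (rule sum.cong) (use clinear_tensor_map[of 0 m id] clinear_product in \<open>auto simp: clinear_iff tensor_map_def\<close>)
  hence *: "coder m (basis I) = m (basis I) +
    (\<Sum>(J, K)\<in>splits I. of_nat (choose3 (expo I) (expo J)) *\<^sub>C
     (\<Sum>j\<in>{1,2,3}. Poly_Mapping.lookup (m (basis J)) (Midx (unit3 j)) *\<^sub>C mon (unit3 j + expo K)))"
    by (simp add: coder_def t del: unit3.simps)
  show ?thesis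
    unfolding * lookup_add lookup_sum
    by (intro arg_cong2[where f = "(+)"] sum.cong refl) (clarsimp simp: lookup_add lookup_mon simp del: unit3.simps)
qed

lemma lookup_coder:
  assumes "m \<in> L" "finite X" "{P. choose3 (expo I) (expo P) \<noteq> 0} \<subseteq> X"
  shows "Poly_Mapping.lookup (coder m (basis I)) M =
    (\<Sum>P\<in>X. \<Sum>j\<in>{1,2,3}. Poly_Mapping.lookup (m (basis P)) (Midx (unit3 j)) * elem P j I M)"
proof -
  let ?g = "\<lambda>P. \<Sum>j\<in>{1,2,3}. Poly_Mapping.lookup (m (basis P)) (Midx (unit3 j)) * elem P j I M"
  have chI: "choose3 (expo I) (expo I) = 1" by (cases "expo I") auto
  let ?S = "fst ` splits I"
  have I: "I \<notin> ?S"
    using expo_mem(2) by (auto simp: splits_def zero_prod_def)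
  have sub: "insert I ?S \<subseteq> X" using assms(3) splits_below(1) chI by fastforce
  have out: "?g P = 0" if "P \<in> X - insert I ?S" for P
  proof -
    have "choose3 (expo I) (expo P) = 0"
    proof (rule ccontr)
      assume c: "choose3 (expo I) (expo P) \<noteq> 0"
      hence s: "expo P + (expo I - expo P) = expo I" by (cases "expo I"; cases "expo P") auto
      have "expo I - expo P \<noteq> (0, 0, 0)" using that s by (auto simp: zero_prod_def[symmetric])
      moreover have "fst (expo I - expo P) \<le> 1" using expo_mem(1)[of I] by simp
      ultimately have "expo I - expo P \<in> range expo" unfolding range_expo by (cases "expo I - expo P") auto
      then obtain K where "expo I - expo P = expo K" by auto
      with s have "(P, K) \<in> splits I" by (simp add: splits_def)
      thus False using that by force
    qed
    thus ?thesis by (simp add: elem_def)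
  qed
  have gI: "?g I = Poly_Mapping.lookup (m (basis I)) M"
  proof -
    have "m (basis I) \<in> W" using assms(1) by (auto simp: L_def)
    from W_expand[OF this] have "Poly_Mapping.lookup (m (basis I)) M = Poly_Mapping.lookup
       (\<Sum>j\<in>{1,2,3}. Poly_Mapping.lookup (m (basis I)) (Midx (unit3 j)) *\<^sub>C w j) M" by simp
    thus ?thesis unfolding lookup_sum
      by (simp add: elem_def chI w_def lookup_mon add.commute[of "expo M"] del: unit3.simps)
  qed
  have "(\<Sum>P\<in>X. ?g P) = (\<Sum>P\<in>insert I ?S. ?g P)"
    by (rule sum.mono_neutral_right) (use assms(2) sub out in auto)
  also have "\<dots> = ?g I + (\<Sum>P\<in>?S. ?g P)" using I by (subst sum.insert) auto
  also have "(\<Sum>P\<in>?S. ?g P) = (\<Sum>p\<in>splits I. ?g (fst p))"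
    by (subst sum.reindex) (auto intro!: inj_onI simp: splits_def, metis add_left_cancel expo_inject)
  also have "\<dots> = (\<Sum>(J, K)\<in>splits I. of_nat (choose3 (expo I) (expo J)) *
      (\<Sum>j\<in>{1,2,3}. Poly_Mapping.lookup (m (basis J)) (Midx (unit3 j)) * of_bool (expo M = unit3 j + expo K)))"
  proof (rule sum.cong[OF refl], clarify)
    fix J K assume "(J, K) \<in> splits I"
    hence e: "expo I = expo J + expo K" by (simp add: splits_def)
    have "expo M + expo J = expo I + unit3 j \<longleftrightarrow> expo M = unit3 j + expo K" for j
      unfolding e by (metis (no_types) add.assoc add.commute add_left_cancel)
    hence *: "elem J j I M = of_nat (choose3 (expo I) (expo J)) * of_bool (expo M = unit3 j + expo K)" for j
      by (simp add: elem_def del: unit3.simps)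
    show "?g (fst (J, K)) = of_nat (choose3 (expo I) (expo J)) *
      (\<Sum>j\<in>{1,2,3}. Poly_Mapping.lookup (m (basis J)) (Midx (unit3 j)) * of_bool (expo M = unit3 j + expo K))"
      unfolding fst_conv * sum_distrib_left by (rule sum.cong) (auto simp del: unit3.simps)
  qed
  finally show ?thesis using coder_basis[OF assms(1)] gI by simp
qed

lemma binom_same:
  fixes a b p i :: nat
  assumes "a + b + p = i"
  shows "(i choose b) * ((i - b) choose p) = (i choose p) * ((a + b) choose a)"
    and "(i choose a) * ((i - a) choose p) = (i choose p) * ((a + b) choose a)"
proof -
  have f: "fact x * fact y * ((x + y) choose x) = (fact (x + y) :: nat)" for x y :: nat
    using binomial_fact_lemma[of x "x + y"] by simp
  have "fact a * fact b * fact p * ((i choose b) * ((i - b) choose p)) = (fact i :: nat)"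
  proof -
    have "fact a * fact b * fact p * ((i choose b) * ((i - b) choose p)) = fact b * (fact p * fact a * ((i - b) choose p)) * ((i choose b) :: nat)"
      by (simp only: mult_ac)
    also have "fact p * fact a * ((i - b) choose p) = (fact (p + a) :: nat)"
      using f[of p a] assms[symmetric] by (simp add: add_ac)
    also have "fact b * fact (p + a) * (i choose b) = (fact i :: nat)"
      using f[of b "p + a"] assms[symmetric] by (simp add: add_ac)
    finally show ?thesis .
  qed
  moreover have "fact a * fact b * fact p * ((i choose a) * ((i - a) choose p)) = (fact i :: nat)"
  proof -
    have "fact a * fact b * fact p * ((i choose a) * ((i - a) choose p)) = fact a * (fact p * fact b * ((i - a) choose p)) * ((i choose a) :: nat)"
      by (simp only: mult_ac)
    also have "fact p * fact b * ((i - a) choose p) = (fact (p + b) :: nat)"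
      using f[of p b] assms[symmetric] by (simp add: add_ac)
    also have "fact a * fact (p + b) * (i choose a) = (fact i :: nat)"
      using f[of a "p + b"] assms[symmetric] by (simp add: add_ac)
    finally show ?thesis .
  qed
  moreover have "fact a * fact b * fact p * ((i choose p) * ((a + b) choose a)) = (fact i :: nat)"
  proof -
    have "fact a * fact b * fact p * ((i choose p) * ((a + b) choose a)) = fact p * (fact a * fact b * ((a + b) choose a)) * ((i choose p) :: nat)"
      by (simp only: mult_ac)
    also have "fact a * fact b * ((a + b) choose a) = (fact (a + b) :: nat)"
      using f[of a b] assms[symmetric] by (simp add: add_ac)
    also have "fact p * fact (a + b) * (i choose p) = (fact i :: nat)"
      using f[of p "a + b"] assms[symmetric] by (simp add: add_ac)
    finally show ?thesis .
  qed
  ultimately show "(i choose b) * ((i - b) choose p) = (i choose p) * ((a + b) choose a)"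
    and "(i choose a) * ((i - a) choose p) = (i choose p) * ((a + b) choose a)"
    by (metis fact_nonzero mult_left_cancel mult_eq_0_iff)+
qed

lemma binom_step:
  fixes a b p i :: nat
  assumes "a + b + p = Suc i"
  shows "(i choose b) * ((i - b) choose p) + (i choose a) * ((i - a) choose p)
    = (i choose p) * ((a + b) choose a)"
proof (cases "a = 0 \<or> b = 0")
  case True
  have z: "(i choose b) * ((i - b) choose p) = 0" if "a = 0"
    using that assms by (cases "p = 0") (auto simp: binomial_eq_0)
  have z': "(i choose a) * ((i - a) choose p) = 0" if "b = 0"
    using that assms by (cases "p = 0") (auto simp: binomial_eq_0)
  show ?thesis using True
  proof
    assume "a = 0" thus ?thesis using z by simp
  next
    assume "b = 0" thus ?thesis using z' by simp
  qed
next
  case False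
  then obtain a' b' where ab: "a = Suc a'" "b = Suc b'" by (meson not0_implies_Suc)
  have "(i choose b) * ((i - b) choose p) = (i choose p) * ((a' + b) choose a')"
    by (rule binom_same(1)) (use assms ab in simp)
  moreover have "(i choose a) * ((i - a) choose p) = (i choose p) * ((a + b') choose a)"
    by (rule binom_same(2)) (use assms ab in simp)
  ultimately show ?thesis by (simp add: ab algebra_simps)
qed

lemma choose3_sym: "choose3 (i + j) i = choose3 (i + j) j"
proof -
  obtain a b c where i: "i = (a, b, c)" by (cases i)
  obtain a' b' c' where j: "j = (a', b', c')" by (cases j)
  show ?thesis
    using binomial_symmetric[of a "a + a'"] binomial_symmetric[of b "b + b'"]
      binomial_symmetric[of c "c + c'"]
    by (simp add: i j)
qed

lemma elem_fst:
  "(if \<exists>J. expo J + expo B = expo I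
    then of_nat (choose3 (expo I) (expo (Midx (expo I - expo B)))) * elem P j (Midx (expo I - expo B)) A else 0)
   = (if expo A + expo B + expo P = expo I + unit3 j
      then of_nat (choose3 (expo I) (expo B) * choose3 (expo I - expo B) (expo P)) else 0)"
proof (cases "\<exists>J. expo J + expo B = expo I")
  case True
  then obtain J where J: "expo I = expo J + expo B" by metis
  hence d: "expo I - expo B = expo J" by simp
  have c: "choose3 (expo I) (expo J) = choose3 (expo I) (expo B)"
    unfolding J by (rule choose3_sym)
  have e: "expo A + expo B + expo P = expo I + unit3 j \<longleftrightarrow> expo A + expo P = expo J + unit3 j"
  proof -
    have "expo A + expo B + expo P = (expo A + expo P) + expo B"
      "expo J + expo B + unit3 j = (expo J + unit3 j) + expo B"
      by (simp_all only: add_ac)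
    thus ?thesis unfolding J by (metis add_right_cancel)
  qed
  show ?thesis using True by (simp add: d c e elem_def expo_inverse del: unit3.simps)
next
  case False
  have "choose3 (expo I) (expo B) * choose3 (expo I - expo B) (expo P) = 0"
  proof (rule ccontr)
    assume "\<not> ?thesis"
    hence c: "choose3 (expo I) (expo B) \<noteq> 0" "choose3 (expo I - expo B) (expo P) \<noteq> 0" by auto
    have s: "expo I - expo B + expo B = expo I" using c(1) by (cases "expo I"; cases "expo B") auto
    have "expo I - expo B \<noteq> (0, 0, 0)" using c(2) expo_mem(2)[of P] by (cases "expo P") auto
    moreover have "fst (expo I - expo B) \<le> 1" using expo_mem(1)[of I] by simp
    ultimately have "expo I - expo B \<in> range expo" unfolding range_expo by (cases "expo I - expo B") auto
    thus False using False s by (metis rangeE)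
  qed
  thus ?thesis using False by simp
qed

lemma elem_key_nat:
  assumes "j \<in> {1,2,3}" "even (fst P + of_bool (j = 1) + p)" "fst I \<le> 1" "fst A \<le> 1" "fst B \<le> 1"
    "A + B + P = I + unit3 j"
  shows "(if fst A + fst B \<le> 1 then of_nat (choose3 (A + B) A * choose3 I P) else (0::complex))
    = of_nat (choose3 I B * choose3 (I - B) P) + (- 1) ^ (p * fst A) * of_nat (choose3 I A * choose3 (I - A) P)"
proof -
  obtain a1 a2 a3 where A: "A = (a1, a2, a3)" by (cases A)
  obtain b1 b2 b3 where B: "B = (b1, b2, b3)" by (cases B)
  obtain p1 p2 p3 where P: "P = (p1, p2, p3)" by (cases P)
  obtain i1 i2 i3 where I: "I = (i1, i2, i3)" by (cases I)
  have eq: "a1 + b1 + p1 = i1 + of_bool (j = 1)" "a2 + b2 + p2 = i2 + of_bool (j = 2)"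
    "a3 + b3 + p3 = i3 + of_bool (j = 3)"
    using assms(6) by (simp_all add: A B P I)
  have 01: "i1 \<in> {0,1}" "a1 \<in> {0,1}" "b1 \<in> {0,1}" using assms by (auto simp: A B I)
  consider "j = 1" | "j = 2" | "j = 3" using assms(1) by auto
  thus ?thesis
  proof cases
    case 1
    have s: "a2 + b2 + p2 = i2" "a3 + b3 + p3 = i3" using eq 1 by auto
    have p1: "p1 = i1 + 1 - a1 - b1" using eq(1) 1 by simp
    define z where "z = ((i2 choose p2) * ((a2 + b2) choose a2)) * ((i3 choose p3) * ((a3 + b3) choose a3))"
    have "choose3 I B * choose3 (I - B) P = ((i1 choose b1) * ((i1 - b1) choose p1)) *
        (((i2 choose b2) * ((i2 - b2) choose p2)) * ((i3 choose b3) * ((i3 - b3) choose p3)))"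
      by (simp add: A B P I)
    hence zB: "choose3 I B * choose3 (I - B) P = ((i1 choose b1) * ((i1 - b1) choose p1)) * z"
      unfolding binom_same[OF s(1)] binom_same[OF s(2)] z_def .
    have "choose3 I A * choose3 (I - A) P = ((i1 choose a1) * ((i1 - a1) choose p1)) *
        (((i2 choose a2) * ((i2 - a2) choose p2)) * ((i3 choose a3) * ((i3 - a3) choose p3)))"
      by (simp add: A B P I)
    hence zA: "choose3 I A * choose3 (I - A) P = ((i1 choose a1) * ((i1 - a1) choose p1)) * z"
      unfolding binom_same[OF s(1)] binom_same[OF s(2)] z_def .
    have zAB: "choose3 (A + B) A * choose3 I P = ((i1 choose p1) * ((a1 + b1) choose a1)) * z"
      by (simp add: A B P I z_def)
    show ?thesis unfolding zA zB zAB
      using 01 1 assms(2) eq(1) by (auto simp: A B P p1)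
  next
    case 2
    have s: "a1 + b1 + p1 = i1" "a3 + b3 + p3 = i3" "a2 + b2 + p2 = Suc i2" using eq 2 by auto
    have sg: "(- 1 :: complex) ^ (p * fst A) = 1"
      using s(1) 01 assms(2) 2 by (auto simp: A P)
    have "choose3 I B * choose3 (I - B) P + choose3 I A * choose3 (I - A) P =
       ((i1 choose b1) * ((i1 - b1) choose p1)) * ((i3 choose b3) * ((i3 - b3) choose p3)) * ((i2 choose b2) * ((i2 - b2) choose p2))
       + ((i1 choose a1) * ((i1 - a1) choose p1)) * ((i3 choose a3) * ((i3 - a3) choose p3)) * ((i2 choose a2) * ((i2 - a2) choose p2))"
      by (simp add: A B P I)
    also have "\<dots> = choose3 (A + B) A * choose3 I P"
      unfolding binom_same[OF s(1)] binom_same[OF s(2)] distrib_left[symmetric] binom_step[OF s(3)]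
      by (simp add: A B P I)
    finally show ?thesis using s(1) 01 unfolding sg mult_1 of_nat_add[symmetric] by (auto simp: A B)
  next
    case 3
    have s: "a1 + b1 + p1 = i1" "a2 + b2 + p2 = i2" "a3 + b3 + p3 = Suc i3" using eq 3 by auto
    have sg: "(- 1 :: complex) ^ (p * fst A) = 1"
      using s(1) 01 assms(2) 3 by (auto simp: A P)
    have "choose3 I B * choose3 (I - B) P + choose3 I A * choose3 (I - A) P =
       ((i1 choose b1) * ((i1 - b1) choose p1)) * ((i2 choose b2) * ((i2 - b2) choose p2)) * ((i3 choose b3) * ((i3 - b3) choose p3))
       + ((i1 choose a1) * ((i1 - a1) choose p1)) * ((i2 choose a2) * ((i2 - a2) choose p2)) * ((i3 choose a3) * ((i3 - a3) choose p3))"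
      by (simp add: A B P I)
    also have "\<dots> = choose3 (A + B) A * choose3 I P"
      unfolding binom_same[OF s(1)] binom_same[OF s(2)] distrib_left[symmetric] binom_step[OF s(3)]
      by (simp add: A B P I)
    finally show ?thesis using s(1) 01 unfolding sg mult_1 of_nat_add[symmetric] by (auto simp: A B)
  qed
qed

lemma elem_key:
  assumes "j \<in> {1,2,3}" "even (parity P + of_bool (j = 1) + p)"
  shows "(if expo A + expo B \<in> range expo
      then of_nat (choose3 (expo A + expo B) (expo A)) * elem P j I (Midx (expo A + expo B)) else 0)
    = (if \<exists>J. expo J + expo B = expo I
       then of_nat (choose3 (expo I) (expo (Midx (expo I - expo B)))) * elem P j (Midx (expo I - expo B)) A else 0)
    + (if \<exists>K. expo A + expo K = expo I
       then of_nat (choose3 (expo I) (expo A)) * (- 1) ^ (p * parity A) * elem P j (Midx (expo I - expo A)) B else 0)"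
proof -
  let ?s = "expo A + expo B + expo P = expo I + unit3 j"
  have sym: "(if \<exists>K. expo A + expo K = expo I
       then of_nat (choose3 (expo I) (expo A)) * (- 1) ^ (p * parity A) * elem P j (Midx (expo I - expo A)) B else 0)
    = (- 1) ^ (p * parity A) * (if \<exists>J. expo J + expo A = expo I
       then of_nat (choose3 (expo I) (expo (Midx (expo I - expo A)))) * elem P j (Midx (expo I - expo A)) B else 0)"
  proof (cases "\<exists>K. expo A + expo K = expo I")
    case True
    then obtain K where K: "expo I = expo A + expo K" by metis
    have "choose3 (expo I) (expo K) = choose3 (expo I) (expo A)"
      unfolding K by (rule choose3_sym[symmetric])
    moreover have "Midx (expo I - expo A) = K" by (simp add: K expo_inverse)
    moreover have "\<exists>J. expo J + expo A = expo I" using K by (metis add.commute)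
    ultimately show ?thesis using True by simp
  next
    case False
    hence "\<not> (\<exists>J. expo J + expo A = expo I)" by (metis add.commute)
    thus ?thesis using False by simp
  qed
  have r: "expo A + expo B \<in> range expo \<longleftrightarrow> fst (expo A) + fst (expo B) \<le> 1"
    unfolding range_expo using expo_mem(2)[of A] by (cases "expo A"; cases "expo B") auto
  have l: "(if expo A + expo B \<in> range expo
      then of_nat (choose3 (expo A + expo B) (expo A)) * elem P j I (Midx (expo A + expo B)) else 0)
    = (if ?s then (if fst (expo A) + fst (expo B) \<le> 1
         then of_nat (choose3 (expo A + expo B) (expo A) * choose3 (expo I) (expo P)) else 0) else (0::complex))"
    unfolding r[symmetric] by (auto simp: elem_def expo_Midx simp del: unit3.simps)
  have comm: "expo B + expo A + expo P = expo A + expo B + expo P" by (simp add: add_ac)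
  show ?thesis
    unfolding l sym elem_fst comm
    using elem_key_nat[of j "expo P" p "expo I" "expo A" "expo B"] assms expo_mem(1)
    by (simp add: parity_def del: unit3.simps of_nat_mult)
qed

lemma homogeneous_mapD:
  assumes "homogeneous_map p f" "Poly_Mapping.lookup (f (basis I)) M \<noteq> 0"
  shows "even (parity I + parity M + p)"
proof -
  have "basis I \<in> graded_part (parity I)" by (simp add: graded_part_def)
  hence "f (basis I) \<in> graded_part (parity I + p)" using assms(1) by (auto simp: homogeneous_map_def)
  thus ?thesis using assms(2) by (auto simp: graded_part_def in_keys_iff)
qed

lemma homogeneous_mapI:
  assumes "clinear f" "\<And>I M. Poly_Mapping.lookup (f (basis I)) M \<noteq> 0 \<Longrightarrow> even (parity I + parity M + p)"
  shows "homogeneous_map p f"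
  unfolding homogeneous_map_def
proof (intro allI subsetI, elim imageE, clarify)
  fix q v assume v: "v \<in> graded_part q"
  have "even (parity M + (q + p))" if "Poly_Mapping.lookup (f v) M \<noteq> 0" for M
  proof -
    have "(\<Sum>I\<in>Poly_Mapping.keys v. Poly_Mapping.lookup v I * Poly_Mapping.lookup (f (basis I)) M) \<noteq> 0"
      using that clinear_eq_extend[OF assms(1), of v] by (simp add: lookup_extend)
    then obtain I where "I \<in> Poly_Mapping.keys v" "Poly_Mapping.lookup (f (basis I)) M \<noteq> 0"
      by (metis (no_types, lifting) mult_eq_0_iff sum.neutral)
    thus ?thesis using assms(2) v by (fastforce simp: graded_part_def)
  qed
  thus "f v \<in> graded_part (q + p)" by (auto simp: graded_part_def in_keys_iff)
qed

lemma clinear_coder: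
  assumes "m \<in> L" shows "clinear (coder m)"
proof -
  have "clinear m" using assms by (simp add: L_def)
  thus ?thesis unfolding coder_def
    by (intro clinear_plus clinear_comp[OF clinear_product] clinear_comp[OF clinear_tensor_map] clinear_coproduct)
qed

lemma coder_coderivation:
  assumes m: "m \<in> L" and hom: "homogeneous_map p m"
  shows "coderivation p (coder m)"
  unfolding coderivation_def
proof (intro conjI allI)
  let ?D = "coder m"
  let ?a = "\<lambda>P j. Poly_Mapping.lookup (m (basis P)) (Midx (unit3 j))"
  show D: "clinear ?D" by (rule clinear_coder[OF m])
  have ev: "even (parity P + of_bool (j = 1) + p)" if "?a P j \<noteq> 0" "j \<in> {1,2,3}" for P j
    using homogeneous_mapD[OF hom that(1)] unit3_range[OF that(2)] parity_unit[of j]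
    by (simp add: parity_def expo_Midx del: unit3.simps)
  show "homogeneous_map p ?D"
  proof (rule homogeneous_mapI[OF D])
    fix I M assume "Poly_Mapping.lookup (?D (basis I)) M \<noteq> 0"
    then obtain P j where *: "j \<in> {1,2,3}" "?a P j * elem P j I M \<noteq> 0"
      unfolding lookup_coder[OF m finite_below[of I] order.refl] by (meson sum.neutral)
    hence "expo M + expo P = expo I + unit3 j" by (auto simp: elem_def simp del: unit3.simps split: if_splits)
    from arg_cong[OF this, of fst] have "parity M + parity P = parity I + of_bool (j = 1)"
      using parity_unit[of j] by (simp add: parity_def del: unit3.simps)
    moreover have "even (parity P + of_bool (j = 1) + p)" using ev * by auto
    ultimately show "even (parity I + parity M + p)" by presburger
  qed
  fix v
  show "coproduct (?D v) = tensor_map 0 ?D id (coproduct v) + tensor_map p id ?D (coproduct v)"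
  proof (rule clinear_eqI[where f = "\<lambda>v. coproduct (?D v)"])
    show "clinear (\<lambda>v. coproduct (?D v))" by (rule clinear_comp[OF clinear_coproduct D])
    show "clinear (\<lambda>v. tensor_map 0 ?D id (coproduct v) + tensor_map p id ?D (coproduct v))"
      by (intro clinear_plus clinear_comp[OF clinear_tensor_map] clinear_coproduct)
  next
    fix I
    show "coproduct (?D (basis I)) =
      tensor_map 0 ?D id (coproduct (basis I)) + tensor_map p id ?D (coproduct (basis I))"
    proof (rule poly_mapping_eqI, clarify)
      fix A B
      define X where "X = insert I (fst ` splits I \<union> snd ` splits I)"
      define Y where "Y = (\<Union>J\<in>X. {P. choose3 (expo J) (expo P) \<noteq> 0})"
      have Y: "finite Y" unfolding Y_def X_def by (intro finite_UN_I finite_below) auto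
      have lc: "Poly_Mapping.lookup (?D (basis J)) M = (\<Sum>P\<in>Y. \<Sum>j\<in>{1,2,3}. ?a P j * elem P j J M)"
        if "J \<in> X" for J M
        by (rule lookup_coder[OF m Y]) (use that in \<open>auto simp: Y_def\<close>)
      let ?S = "\<lambda>h. \<Sum>P\<in>Y. \<Sum>j\<in>{1,2,3}. ?a P j * h P j"
      have pull: "(if b then c * ?S h else 0) = ?S (\<lambda>P j. if b then c * h P j else 0)" for b c h
        by (cases b) (simp_all only: sum_distrib_left mult_ac if_True if_False mult_zero_right mult_zero_left sum.neutral_const)
      have L: "Poly_Mapping.lookup (coproduct (?D (basis I))) (A, B) = ?S (\<lambda>P j.
        if expo A + expo B \<in> range expo
        then of_nat (choose3 (expo A + expo B) (expo A)) * elem P j I (Midx (expo A + expo B)) else 0)"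
        unfolding lookup_coproduct pull[symmetric]
        by (intro if_cong refl arg_cong2[where f = "(*)"] lc) (simp add: X_def)
      have R1: "Poly_Mapping.lookup (tensor_map 0 ?D id (coproduct (basis I))) (A, B) = ?S (\<lambda>P j.
        if \<exists>J. expo J + expo B = expo I
        then of_nat (choose3 (expo I) (expo (Midx (expo I - expo B)))) * elem P j (Midx (expo I - expo B)) A else 0)"
      proof -
        have "Poly_Mapping.lookup (tensor_map 0 ?D id (coproduct (basis I))) (A, B)
          = (\<Sum>(J, K)\<in>splits I. if K = B then of_nat (choose3 (expo I) (expo J)) * ?S (\<lambda>P j. elem P j J A) else 0)"
          unfolding lookup_tensor_map_coproduct
        proof (rule sum.cong[OF refl], clarify)
          fix J K assume "(J, K) \<in> splits I"
          hence "J \<in> X" unfolding X_def by force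
          thus "of_nat (choose3 (expo I) (expo J)) * (- 1) ^ (0 * parity J) * Poly_Mapping.lookup (?D (basis J)) A *
              Poly_Mapping.lookup (id (basis K)) B
            = (if K = B then of_nat (choose3 (expo I) (expo J)) * ?S (\<lambda>P j. elem P j J A) else 0)"
            by (simp add: lc lookup_single when_def del: unit3.simps)
        qed
        from this[unfolded sum_splits_snd] show ?thesis unfolding pull .
      qed
      have R2: "Poly_Mapping.lookup (tensor_map p id ?D (coproduct (basis I))) (A, B) = ?S (\<lambda>P j.
        if \<exists>K. expo A + expo K = expo I
        then of_nat (choose3 (expo I) (expo A)) * (- 1) ^ (p * parity A) * elem P j (Midx (expo I - expo A)) B else 0)"
      proof -
        have "Poly_Mapping.lookup (tensor_map p id ?D (coproduct (basis I))) (A, B)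
          = (\<Sum>(J, K)\<in>splits I. if J = A then
               (of_nat (choose3 (expo I) (expo J)) * (- 1) ^ (p * parity J)) * ?S (\<lambda>P j. elem P j K B) else 0)"
          unfolding lookup_tensor_map_coproduct
        proof (rule sum.cong[OF refl], clarify)
          fix J K assume "(J, K) \<in> splits I"
          hence "K \<in> X" unfolding X_def by force
          thus "of_nat (choose3 (expo I) (expo J)) * (- 1) ^ (p * parity J) * Poly_Mapping.lookup (id (basis J)) A *
              Poly_Mapping.lookup (?D (basis K)) B
            = (if J = A then (of_nat (choose3 (expo I) (expo J)) * (- 1) ^ (p * parity J))
                 * ?S (\<lambda>P j. elem P j K B) else 0)"
            by (simp add: lc lookup_single when_def del: unit3.simps)
        qed
        from this[unfolded sum_splits_fst] show ?thesis unfolding pull .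
      qed
      show "Poly_Mapping.lookup (coproduct (?D (basis I))) (A, B) = Poly_Mapping.lookup
        (tensor_map 0 ?D id (coproduct (basis I)) + tensor_map p id ?D (coproduct (basis I))) (A, B)"
        unfolding lookup_add L R1 R2 sum.distrib[symmetric] distrib_left[symmetric]
      proof (intro sum.cong refl)
        fix P j assume "j \<in> {1, 2, 3::nat}"
        thus "?a P j * (if expo A + expo B \<in> range expo
            then of_nat (choose3 (expo A + expo B) (expo A)) * elem P j I (Midx (expo A + expo B)) else 0)
          = ?a P j * ((if \<exists>J. expo J + expo B = expo I
            then of_nat (choose3 (expo I) (expo (Midx (expo I - expo B)))) * elem P j (Midx (expo I - expo B)) A else 0)
            + (if \<exists>K. expo A + expo K = expo I
               then of_nat (choose3 (expo I) (expo A)) * (- 1) ^ (p * parity A) * elem P j (Midx (expo I - expo A)) B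
               else 0))"
          using ev[of P j] elem_key[of j P p A B I] by (cases "?a P j = 0") auto
      qed
    qed
  qed
qed

lemma lookup_to_W:
  "Poly_Mapping.lookup (to_W v) M = (if size3 (expo M) = 1 then Poly_Mapping.lookup v M else 0)"
proof -
  have "Poly_Mapping.lookup (to_W v) M = (\<Sum>I\<in>Poly_Mapping.keys v. if I = M then
      (if size3 (expo M) = 1 then Poly_Mapping.lookup v M else 0) else 0)"
    unfolding to_W_def lookup_extend by (rule sum.cong) (auto simp: lookup_single when_def)
  thus ?thesis by (simp add: in_keys_iff)
qed

lemma size3_add: "size3 (i + j) = size3 i + size3 j"
  by (cases i; cases j) simp

lemma size3_pos: "size3 (expo I) > 0"
  using expo_mem(2)[of I] by (cases "expo I") auto

lemma to_W_coder:
  assumes "m \<in> L"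
  shows "to_W (coder m v) = m v"
proof (rule clinear_eqI[where f = "\<lambda>v. to_W (coder m v)"])
  show "clinear (\<lambda>v. to_W (coder m v))" by (rule clinear_comp[OF clinear_to_W clinear_coder[OF assms]])
  show "clinear m" using assms by (simp add: L_def)
  fix I
  show "to_W (coder m (basis I)) = m (basis I)"
  proof (rule poly_mapping_eqI)
    fix M
    have "m (basis I) \<in> W" using assms by (auto simp: L_def)
    hence "Poly_Mapping.lookup (m (basis I)) M = 0" if "size3 (expo M) \<noteq> 1"
      using that by (simp add: in_W_iff)
    moreover have "expo M \<noteq> unit3 j + expo K" if "size3 (expo M) = 1" "j \<in> {1,2,3}" for j K
    proof
      assume "expo M = unit3 j + expo K"
      hence "size3 (expo M) = size3 (unit3 j) + size3 (expo K)" by (simp add: size3_add del: unit3.simps)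
      thus False using that size3_pos[of K] size3_1[of "unit3 j"] by auto
    qed
    ultimately show "Poly_Mapping.lookup (to_W (coder m (basis I))) M = Poly_Mapping.lookup (m (basis I)) M"
      by (auto simp: lookup_to_W coder_basis[OF assms] simp del: unit3.simps intro!: sum.neutral)
  qed
qed

lemma coproduct_eq_0_imp_W:
  assumes "coproduct v = 0"
  shows "v \<in> W"
  unfolding in_W_iff
proof (intro allI impI)
  fix I assume ns: "size3 (expo I) \<noteq> 1"
  obtain i1 i2 i3 where I: "expo I = (i1, i2, i3)" by (cases "expo I")
  have i1: "i1 \<le> 1" using expo_mem(1)[of I] I by simp
  have "\<exists>j\<in>{1,2,3}. choose3 (expo I) (unit3 j) \<noteq> 0" using size3_pos[of I] by (auto simp: I)
  then obtain j where j: "j \<in> {1,2,3}" "choose3 (expo I) (unit3 j) \<noteq> 0" by blast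
  have s: "unit3 j + (expo I - unit3 j) = expo I" using j(2) by (auto simp: I)
  have "expo I - unit3 j \<noteq> (0, 0, 0)"
  proof
    assume "expo I - unit3 j = (0, 0, 0)"
    hence "size3 (expo I) = size3 (unit3 j)" using s by (metis add_0_right zero_prod_def)
    moreover have "size3 (unit3 j) = 1" using j(1) by auto
    ultimately show False using ns by simp
  qed
  hence "expo I - unit3 j \<in> range expo" using i1 unfolding range_expo I by auto
  hence "unit3 j = expo (Midx (unit3 j))" "expo I - unit3 j = expo (Midx (expo I - unit3 j))"
    using unit3_range[OF j(1)] by (simp_all only: expo_Midx)
  then obtain A B where AB: "expo A = unit3 j" "expo A + expo B = expo I" using s by metis
  have "Poly_Mapping.lookup (coproduct v) (A, B) = 0" by (simp add: assms)
  thus "Poly_Mapping.lookup v I = 0"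
    unfolding lookup_coproduct AB(2) using j(2) by (simp add: AB(1) expo_inverse del: unit3.simps)
qed

lemma coderivation_unique:
  assumes D: "coderivation p D" and E: "coderivation p E" and eq: "\<And>v. to_W (D v) = to_W (E v)"
  shows "D = E"
proof -
  have lin: "clinear D" "clinear E" using D E by (auto simp: coderivation_def)
  have "D (basis I) = E (basis I)" for I
  proof (induction "size3 (expo I)" arbitrary: I rule: less_induct)
    case less
    have sm: "D (basis J) = E (basis J)" "D (basis K) = E (basis K)" if "(J, K) \<in> splits I" for J K
    proof -
      have "size3 (expo I) = size3 (expo J) + size3 (expo K)"
        using that by (simp add: splits_def size3_add[symmetric])
      thus "D (basis J) = E (basis J)" "D (basis K) = E (basis K)"
        using less size3_pos[of J] size3_pos[of K] by auto
    qed
    have "coproduct (D (basis I)) = coproduct (E (basis I))"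
    proof (rule poly_mapping_eqI, clarify)
      fix A B
      have *: "coproduct (F (basis I)) = tensor_map 0 F id (coproduct (basis I)) + tensor_map p id F (coproduct (basis I))"
        if "coderivation p F" for F using that by (simp add: coderivation_def)
      show "Poly_Mapping.lookup (coproduct (D (basis I))) (A, B) = Poly_Mapping.lookup (coproduct (E (basis I))) (A, B)"
        unfolding *[OF D] *[OF E] lookup_add lookup_tensor_map_coproduct
        by (intro arg_cong2[where f = "(+)"] sum.cong refl) (auto simp: sm)
    qed
    hence "coproduct (D (basis I) - E (basis I)) = 0"
      using clinear_coproduct unfolding clinear_iff by (metis diff_add_cancel add_cancel_left_left)
    hence w: "D (basis I) - E (basis I) \<in> W" by (rule coproduct_eq_0_imp_W)
    show ?case
    proof (rule poly_mapping_eqI)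
      fix M
      show "Poly_Mapping.lookup (D (basis I)) M = Poly_Mapping.lookup (E (basis I)) M"
        using w[unfolded in_W_iff, rule_format, of M]
          arg_cong[OF eq[of "basis I"], of "\<lambda>v. Poly_Mapping.lookup v M"]
        by (cases "size3 (expo M) = 1") (auto simp: lookup_to_W lookup_minus)
    qed
  qed
  thus ?thesis using clinear_eqI[OF lin] by blast
qed

lemma coderivation_eq_coder:
  assumes "coderivation p D"
  shows "D = coder (\<lambda>v. to_W (D v))" "(\<lambda>v. to_W (D v)) \<in> L" "homogeneous_map p (\<lambda>v. to_W (D v))"
proof -
  have lin: "clinear D" and hom: "homogeneous_map p D" using assms by (auto simp: coderivation_def)
  have l: "clinear (\<lambda>v. to_W (D v))" by (rule clinear_comp[OF clinear_to_W lin])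
  thus L: "(\<lambda>v. to_W (D v)) \<in> L" by (auto simp: L_def in_W_iff lookup_to_W)
  show H: "homogeneous_map p (\<lambda>v. to_W (D v))"
    by (rule homogeneous_mapI[OF l]) (auto simp: lookup_to_W split: if_splits dest: homogeneous_mapD[OF hom])
  show "D = coder (\<lambda>v. to_W (D v))"
    by (rule coderivation_unique[OF assms coder_coderivation[OF L H]]) (simp add: to_W_coder[OF L])
qed

end

(*
  A codifferential of the first kind sends w_1 v to A v, for v in the span of w_2 and w_3 and a
  2 x 2 matrix A. The linear part of an even automorphism is a scalar l on w_1 together with an
  invertible matrix B on the even part; comparing d g = g d' on S^2(W) gives l A B = B A', where the
  higher parts of g do not enter. Conversely every pair (l, B) extends to an automorphism of S(W).
  So the classes are those of nonzero matrices up to conjugation and scaling, and the normal forms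
  are Jordan forms: d_* is the nilpotent block, d_sharp the invertible block, and d_c the
  diagonal matrix (1, c), where swapping the eigenvalues and rescaling identifies c with 1/c.
*)

theory Submission
  imports Defs "HOL-Computational_Algebra.Polynomial"
begin

abbreviation lookup :: "('a \<Rightarrow>\<^sub>0 complex) \<Rightarrow> 'a \<Rightarrow> complex"
  where "lookup \<equiv> Poly_Mapping.lookup"

subsection \<open>Coalgebra morphisms\<close>

text \<open>Automorphisms without bijectivity: uniqueness of morphisms can then be used to prove
  that a candidate inverse really is one.\<close>

definition coalgebra_morphism :: "(SW \<Rightarrow> SW) \<Rightarrow> bool"
  where "coalgebra_morphism g \<longleftrightarrow> clinear g \<and> homogeneous_map 0 g \<and>
           (\<forall>v. coproduct (g v) = tensor_map 0 g g (coproduct v))"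

section \<open>Tensor products of maps and their Koszul signs\<close>

lemma tensor_map_basis:
  "tensor_map q f g (Poly_Mapping.single (I, J) 1) =
    (- 1) ^ (q * parity I) *\<^sub>C tensor (f (basis I)) (g (basis J))"
  by (simp add: tensor_map_def)

lemma tensor_eq_sum:
  "tensor u v = (\<Sum>I\<in>Poly_Mapping.keys u. \<Sum>J\<in>Poly_Mapping.keys v.
     (lookup u I * lookup v J) *\<^sub>C Poly_Mapping.single (I, J) 1)"
  unfolding tensor_def by (intro sum.cong refl) (auto intro!: poly_mapping_eqI simp: lookup_single when_def)

lemma tensor_linear_maps:
  assumes "clinear f" "clinear g"
  shows "tensor (f u) (g v) = (\<Sum>I\<in>Poly_Mapping.keys u. \<Sum>J\<in>Poly_Mapping.keys v.
     (lookup u I * lookup v J) *\<^sub>C tensor (f (basis I)) (g (basis J)))"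
  by (subst clinear_eq_extend[OF assms(1)], subst clinear_eq_extend[OF assms(2)], rule poly_mapping_eqI)
    (auto simp: lookup_extend lookup_sum sum_product mult_ac intro!: sum.cong)

text \<open>The sign is attached monomial by monomial, so it leaves the sum only as a value
  \<open>s\<close> common to all monomials of \<open>u\<close>, as happens for \<open>q = 0\<close>
  or for homogeneous \<open>u\<close>.\<close>

lemma tensor_map_tensor:
  assumes "clinear f" "clinear g" "\<And>I. I \<in> Poly_Mapping.keys u \<Longrightarrow> (- 1 :: complex) ^ (q * parity I) = s"
  shows "tensor_map q f g (tensor u v) = s *\<^sub>C tensor (f u) (g v)"
proof -
  have "tensor_map q f g (tensor u v) = (\<Sum>I\<in>Poly_Mapping.keys u. \<Sum>J\<in>Poly_Mapping.keys v.
     (lookup u I * lookup v J) *\<^sub>C tensor_map q f g (Poly_Mapping.single (I, J) 1))"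
    unfolding tensor_eq_sum[of u v] clinear_sum[OF clinear_tensor_map]
    using clinear_tensor_map[of q f g] by (simp only: clinear_iff)
  also have "\<dots> = s *\<^sub>C tensor (f u) (g v)"
    by (subst tensor_linear_maps[OF assms(1,2)], unfold poly_mapping.scale_sum_right tensor_map_basis)
      (auto simp: assms(3) mult.commute intro!: sum.cong)
  finally show ?thesis .
qed

lemma tensor_map_comp_left:
  assumes "clinear h" "clinear k"
  shows "tensor_map 0 h k (tensor_map q f g x) = tensor_map q (\<lambda>v. h (f v)) (\<lambda>v. k (g v)) x"
proof (rule clinear_eqI[where f = "\<lambda>x. tensor_map 0 h k (tensor_map q f g x)"])
  fix IJ :: "midx \<times> midx"
  obtain I J where IJ: "IJ = (I, J)" by (cases IJ)
  have sc: "tensor_map 0 h k (c *\<^sub>C x) = c *\<^sub>C tensor_map 0 h k x" for c x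
    using clinear_tensor_map[of 0 h k] by (simp add: clinear_iff)
  show "tensor_map 0 h k (tensor_map q f g (Poly_Mapping.single IJ 1))
      = tensor_map q (\<lambda>v. h (f v)) (\<lambda>v. k (g v)) (Poly_Mapping.single IJ 1)"
    unfolding IJ tensor_map_basis[of q] sc by (subst tensor_map_tensor[OF assms, where s = 1]) auto
qed (rule clinear_comp[OF clinear_tensor_map clinear_tensor_map], rule clinear_tensor_map)

text \<open>An even \<open>h\<close> preserves the parity of the first factor, so the sign is the
  same before and after applying it.\<close>

lemma tensor_map_comp_right:
  assumes "clinear f" "clinear g" and even: "homogeneous_map 0 h"
  shows "tensor_map q f g (tensor_map 0 h k x) = tensor_map q (\<lambda>v. f (h v)) (\<lambda>v. g (k v)) x"
proof (rule clinear_eqI[where f = "\<lambda>x. tensor_map q f g (tensor_map 0 h k x)"])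
  fix IJ :: "midx \<times> midx"
  obtain I J where IJ: "IJ = (I, J)" by (cases IJ)
  have sgn: "(- 1 :: complex) ^ (q * parity K) = (- 1) ^ (q * parity I)"
    if "K \<in> Poly_Mapping.keys (h (basis I))" for K
    using homogeneous_mapD[OF even, of I K] that by (auto simp: in_keys_iff minus_one_power_iff)
  have "tensor_map 0 h k (Poly_Mapping.single (I, J) 1) = tensor (h (basis I)) (k (basis J))"
    by (simp add: tensor_map_basis)
  thus "tensor_map q f g (tensor_map 0 h k (Poly_Mapping.single IJ 1))
      = tensor_map q (\<lambda>v. f (h v)) (\<lambda>v. g (k v)) (Poly_Mapping.single IJ 1)"
    unfolding IJ tensor_map_basis[of q] by (simp add: tensor_map_tensor[OF assms(1,2) sgn])
qed (rule clinear_comp[OF clinear_tensor_map clinear_tensor_map], rule clinear_tensor_map)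

section \<open>Composition and uniqueness of morphisms, conjugation of coderivations\<close>

lemma coalgebra_morphism_id: "coalgebra_morphism (\<lambda>v. v)"
proof -
  have "tensor_map 0 (\<lambda>v. v) (\<lambda>v. v) x = x" for x :: SW2
    by (rule clinear_eqI[where g = "\<lambda>x. x", OF clinear_tensor_map])
      (auto simp: clinear_iff tensor_map_basis tensor_def)
  thus ?thesis by (auto simp: coalgebra_morphism_def clinear_iff homogeneous_map_def)
qed

lemma coalgebra_morphism_comp:
  assumes "coalgebra_morphism g" "coalgebra_morphism h"
  shows "coalgebra_morphism (\<lambda>v. g (h v))"
proof -
  have lin: "clinear g" "clinear h" and hom: "homogeneous_map 0 g" "homogeneous_map 0 h"
    and cp: "coproduct (g v) = tensor_map 0 g g (coproduct v)" "coproduct (h v) = tensor_map 0 h h (coproduct v)" for v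
    using assms by (auto simp: coalgebra_morphism_def)
  have "homogeneous_map 0 (\<lambda>v. g (h v))"
    using hom by (force simp: homogeneous_map_def image_subset_iff)
  thus ?thesis
    unfolding coalgebra_morphism_def cp tensor_map_comp_right[OF lin(1,1) hom(2)]
    using clinear_comp[OF lin] by blast
qed

text \<open>Induction on the degree: the coproduct of the image of \<open>w_I\<close> involves only
  images of monomials of smaller degree, so the difference of the two images has coproduct 0. It is
  therefore in \<open>W\<close>, where the projections already agree.\<close>

lemma coalgebra_morphism_unique:
  assumes g: "coalgebra_morphism g" and h: "coalgebra_morphism h"
    and eq: "\<And>I. to_W (g (basis I)) = to_W (h (basis I))"
  shows "g v = h v"
proof -
  have "g (basis I) = h (basis I)" for I
  proof (induction "size3 (expo I)" arbitrary: I rule: less_induct)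
    case less
    have sm: "g (basis J) = h (basis J)" "g (basis K) = h (basis K)" if "(J, K) \<in> splits I" for J K
    proof -
      have "size3 (expo I) = size3 (expo J) + size3 (expo K)"
        using that by (simp add: splits_def size3_add[symmetric])
      thus "g (basis J) = h (basis J)" "g (basis K) = h (basis K)"
        using less size3_pos[of J] size3_pos[of K] by auto
    qed
    have "coproduct (g (basis I)) = coproduct (h (basis I))"
    proof (rule poly_mapping_eqI, clarify)
      fix A B
      have *: "coproduct (f (basis I)) = tensor_map 0 f f (coproduct (basis I))"
        if "coalgebra_morphism f" for f using that by (simp add: coalgebra_morphism_def)
      show "lookup (coproduct (g (basis I))) (A, B) = lookup (coproduct (h (basis I))) (A, B)"
        unfolding *[OF g] *[OF h] lookup_tensor_map_coproduct
        by (intro sum.cong refl) (auto simp: sm)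
    qed
    hence "coproduct (g (basis I) - h (basis I)) = 0"
      using clinear_coproduct unfolding clinear_iff by (metis diff_add_cancel add_cancel_left_left)
    hence d: "g (basis I) - h (basis I) \<in> W" by (rule coproduct_eq_0_imp_W)
    show ?case
    proof (rule poly_mapping_eqI)
      fix M
      show "lookup (g (basis I)) M = lookup (h (basis I)) M"
        using d[unfolded in_W_iff, rule_format, of M]
          arg_cong[OF eq[of I], of "\<lambda>v. lookup v M"]
        by (cases "size3 (expo M) = 1") (auto simp: lookup_to_W lookup_minus)
    qed
  qed
  thus ?thesis using g h unfolding coalgebra_morphism_def by (blast intro: clinear_eqI)
qed

text \<open>Functoriality moves \<open>h\<close> and \<open>g\<close> into both tensor factors of
  the Leibniz rule. The factor \<open>id\<close> becomes \<open>h\<close> after \<open>g\<close>,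
  which is again the identity.\<close>

lemma coderivation_conj:
  assumes D: "coderivation p D" and g: "coalgebra_morphism g" and h: "coalgebra_morphism h"
    and hg: "\<And>v. h (g v) = v"
  shows "coderivation p (\<lambda>v. h (D (g v)))"
proof -
  have lin: "clinear D" "clinear g" "clinear h"
    and hom: "homogeneous_map p D" "homogeneous_map 0 g" "homogeneous_map 0 h"
    using assms by (auto simp: coderivation_def coalgebra_morphism_def)
  have cp: "coproduct (D v) = tensor_map 0 D id (coproduct v) + tensor_map p id D (coproduct v)"
    "coproduct (g v) = tensor_map 0 g g (coproduct v)" "coproduct (h v) = tensor_map 0 h h (coproduct v)" for v
    using assms by (auto simp: coderivation_def coalgebra_morphism_def)
  have "clinear (\<lambda>v. h (D (g v)))" by (rule clinear_comp[OF lin(3) clinear_comp[OF lin(1,2)]])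
  moreover have "homogeneous_map p (\<lambda>v. h (D (g v)))"
    unfolding homogeneous_map_def image_subset_iff
  proof (intro allI ballI)
    fix q v assume "v \<in> graded_part q"
    hence "g v \<in> graded_part q" using hom(2) by (auto simp: homogeneous_map_def)
    hence "D (g v) \<in> graded_part (q + p)" using hom(1) by (auto simp: homogeneous_map_def)
    thus "h (D (g v)) \<in> graded_part (q + p)" using hom(3) by (auto simp: homogeneous_map_def)
  qed
  moreover have "coproduct (h (D (g v))) = tensor_map 0 (\<lambda>v. h (D (g v))) id (coproduct v)
      + tensor_map p id (\<lambda>v. h (D (g v))) (coproduct v)" for v
  proof -
    have i: "clinear id" by (simp add: clinear_iff)
    have add: "tensor_map 0 h h (x + y) = tensor_map 0 h h x + tensor_map 0 h h y" for x y
      using clinear_tensor_map[of 0 h h] by (simp add: clinear_iff)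
    show ?thesis
      unfolding cp add tensor_map_comp_right[OF lin(1) i hom(2)] tensor_map_comp_right[OF i lin(1) hom(2)]
        tensor_map_comp_left[OF lin(3,3)]
      by (simp add: hg id_def)
  qed
  ultimately show ?thesis by (simp add: coderivation_def)
qed

subsection \<open>Automorphisms induced by linear maps\<close>

text \<open>
  The entry at \<open>(I, A)\<close>, with respect to the divided powers \<open>w_I / I!\<close>, of the map induced by
  \<open>w_1 \<mapsto> l w_1\<close>, \<open>w_2 \<mapsto> p w_2 + q w_3\<close>, \<open>w_3 \<mapsto> r w_2 + s w_3\<close>. Divided powers have a coproduct
  without coefficients, so the generating function of the entries over \<open>I\<close> has to be multiplicative
  in \<open>A\<close>. As the map preserves the degree, the generating function can be taken in the third
  exponent alone.
\<close>

fun subst_entry :: "complex \<Rightarrow> complex \<Rightarrow> complex \<Rightarrow> complex \<Rightarrow> complex \<Rightarrow> nat \<times> nat \<times> nat \<Rightarrow> nat \<times> nat \<times> nat \<Rightarrow> complex"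
  where "subst_entry l p q r s (i1, i2, i3) (a1, a2, a3) =
    (if i1 = a1 \<and> i2 + i3 = a2 + a3 then l ^ a1 * coeff ([:p, r:] ^ a2 * [:q, s:] ^ a3) i3 else 0)"

text \<open>The quotient of factorials converts entries for divided powers into entries for
  monomials.\<close>

definition lin_subst :: "complex \<Rightarrow> complex \<Rightarrow> complex \<Rightarrow> complex \<Rightarrow> complex \<Rightarrow> SW \<Rightarrow> SW"
  where "lin_subst l p q r s = extend (\<lambda>I. \<Sum>A | size3 (expo A) = size3 (expo I).
    Poly_Mapping.single A (of_nat (fact3 (expo I)) / of_nat (fact3 (expo A)) * subst_entry l p q r s (expo I) (expo A)))"

lemma finite_size3: "finite {A. size3 (expo A) = n}"
proof (rule finite_subset)
  show "{A. size3 (expo A) = n} \<subseteq> Midx ` ({..n} \<times> {..n} \<times> {..n})"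
  proof clarify
    fix A assume "n = size3 (expo A)"
    hence "expo A \<in> {..n} \<times> {..n} \<times> {..n}" by (cases "expo A") auto
    thus "A \<in> Midx ` ({..size3 (expo A)} \<times> {..size3 (expo A)} \<times> {..size3 (expo A)})"
      using expo_inverse[of A] \<open>n = _\<close> by (metis imageI)
  qed
qed auto

lemma subst_entry_nonzeroD:
  assumes "subst_entry l p q r s i a \<noteq> 0"
  shows "fst i = fst a" "size3 i = size3 a"
  using assms by (cases i; cases a; auto split: if_splits)+

lemma clinear_lin_subst: "clinear (lin_subst l p q r s)"
  unfolding lin_subst_def by (rule clinear_extend)

lemma lookup_lin_subst_basis:
  "lookup (lin_subst l p q r s (basis I)) A =
    of_nat (fact3 (expo I)) / of_nat (fact3 (expo A)) * subst_entry l p q r s (expo I) (expo A)"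
proof -
  let ?c = "of_nat (fact3 (expo I)) / of_nat (fact3 (expo A)) * subst_entry l p q r s (expo I) (expo A)"
  have "lookup (lin_subst l p q r s (basis I)) A =
     (\<Sum>B | size3 (expo B) = size3 (expo I). if B = A then ?c else 0)"
    by (simp add: lin_subst_def lookup_sum lookup_single when_def cong: if_cong)
  also have "\<dots> = ?c"
    using subst_entry_nonzeroD(2)[of l p q r s "expo I" "expo A"]
    by (cases "subst_entry l p q r s (expo I) (expo A) = 0") (simp_all add: finite_size3)
  finally show ?thesis .
qed

lemma degree_subst_poly: "degree ([:p, r :: complex:] ^ a * [:q, s:] ^ b) \<le> a + b"
proof -
  have "degree [:x, y:] \<le> 1" for x y :: complex by simp
  hence "degree ([:x, y:] ^ n) \<le> n" for x y :: complex and n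
    using degree_power_le[of "[:x, y:]" n] by (metis (no_types) mult.commute mult_1_right mult_le_mono2 order_trans)
  from add_mono[OF this this] show ?thesis by (rule order_trans[OF degree_mult_le])
qed

text \<open>Splitting \<open>I\<close> into \<open>J + K\<close> is a convolution of coefficients.
  The polynomials \<open>[:p, r:] ^ a2 * [:q, s:] ^ a3\<close> multiply when exponents are added, so
  the convolution yields the entry for \<open>A + B\<close>.\<close>

lemma sum_splits_subst_entry:
  "(\<Sum>(J, K)\<in>splits I. subst_entry l p q r s (expo J) (expo A) * subst_entry l p q r s (expo K) (expo B))
    = subst_entry l p q r s (expo I) (expo A + expo B)"
proof -
  obtain i1 i2 i3 where I: "expo I = (i1, i2, i3)" by (cases "expo I")
  obtain a1 a2 a3 where A: "expo A = (a1, a2, a3)" by (cases "expo A")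
  obtain b1 b2 b3 where B: "expo B = (b1, b2, b3)" by (cases "expo B")
  let ?h = "subst_entry l p q r s"
  let ?P = "\<lambda>a2 a3. [:p, r:] ^ a2 * [:q, s:] ^ a3"
  show ?thesis
  proof (cases "i1 = a1 + b1 \<and> i2 + i3 = a2 + b2 + (a3 + b3)")
    \<comment> \<open>If the degrees do not match, every summand has a mismatch in one factor and
      both sides vanish.\<close>
    case False
    have "?h (expo J) (expo A) * ?h (expo K) (expo B) = 0" if "(J, K) \<in> splits I" for J K
    proof -
      obtain j1 j2 j3 where J: "expo J = (j1, j2, j3)" by (cases "expo J")
      obtain k1 k2 k3 where K: "expo K = (k1, k2, k3)" by (cases "expo K")
      show ?thesis using that False by (auto simp: I A B J K splits_def)
    qed
    hence "(\<Sum>(J, K)\<in>splits I. ?h (expo J) (expo A) * ?h (expo K) (expo B)) = 0"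
      by (intro sum.neutral) auto
    thus ?thesis using False by (auto simp: I A B)
  next
    case True
    \<comment> \<open>Only splittings in which \<open>J\<close> matches the degrees of
      \<open>A\<close> contribute; \<open>K\<close> then matches those of \<open>B\<close>. Such a
      splitting is determined by the third exponent \<open>j\<close> of \<open>J\<close>, and the
      bounds in \<open>?T\<close> keep the subtractions in \<open>?f\<close> from
      truncating.\<close>
    let ?S = "{(J, K) \<in> splits I. fst (expo J) = a1 \<and> size3 (expo J) = a1 + a2 + a3}"
    let ?T = "{j. j \<le> i3 \<and> j \<le> a2 + a3 \<and> i3 - j \<le> b2 + b3}"
    let ?m = "\<lambda>j. l ^ i1 * (coeff (?P a2 a3) j * coeff (?P b2 b3) (i3 - j))"
    let ?f = "\<lambda>j. (Midx (a1, a2 + a3 - j, j), Midx (b1, b2 + b3 - (i3 - j), i3 - j))"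
    have in_range: "(a1, a2 + a3 - j, j) \<in> range expo" "(b1, b2 + b3 - (i3 - j), i3 - j) \<in> range expo"
      if "j \<in> ?T" for j
      using expo_mem[of A] expo_mem[of B] that unfolding range_expo A B by auto
    have "(\<Sum>(J, K)\<in>splits I. ?h (expo J) (expo A) * ?h (expo K) (expo B))
        = (\<Sum>(J, K)\<in>?S. ?h (expo J) (expo A) * ?h (expo K) (expo B))"
    proof (rule sum.mono_neutral_right)
      have "?h (expo J) (expo A) = 0" if "(J, K) \<in> splits I - ?S" for J K
        using that subst_entry_nonzeroD[of l p q r s "expo J" "expo A"] by (auto simp: A)
      thus "\<forall>x\<in>splits I - ?S. (case x of (J, K) \<Rightarrow> ?h (expo J) (expo A) * ?h (expo K) (expo B)) = 0"
        by (metis (no_types, lifting) mult_zero_left prod.case_eq_if surj_pair prod.sel)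
    qed auto
    also have "\<dots> = (\<Sum>j\<in>?T. ?m j)"
    proof (rule sum.reindex_bij_witness[where i = ?f and j = "\<lambda>(J, K). snd (snd (expo J))"])
      fix p' assume "p' \<in> ?S"
      then obtain J K where JK: "p' = (J, K)" "(J, K) \<in> splits I" "fst (expo J) = a1" "size3 (expo J) = a1 + a2 + a3"
        by auto
      obtain j1 j2 j3 where J: "expo J = (j1, j2, j3)" by (cases "expo J")
      obtain k1 k2 k3 where K: "expo K = (k1, k2, k3)" by (cases "expo K")
      have e: "j1 = a1" "j2 + j3 = a2 + a3" "j1 + k1 = i1" "j2 + k2 = i2" "j3 + k3 = i3"
        using JK by (auto simp: J K I splits_def)
      hence e': "k1 = b1" "k2 + k3 = b2 + b3" using True by auto
      show "(\<lambda>(J, K). snd (snd (expo J))) p' \<in> ?T" using e e' by (auto simp: JK(1) J)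
      have "(a1, a2 + a3 - j3, j3) = expo J" "(b1, b2 + b3 - (i3 - j3), i3 - j3) = expo K"
        using e e' by (auto simp: J K)
      hence "?f j3 = (J, K)" by (simp only: expo_inverse)
      thus "?f ((\<lambda>(J, K). snd (snd (expo J))) p') = p'" by (simp add: JK(1) J)
      show "?m ((\<lambda>(J, K). snd (snd (expo J))) p') = (case p' of (J, K) \<Rightarrow> ?h (expo J) (expo A) * ?h (expo K) (expo B))"
        using e e' True by (auto simp: JK(1) J K A B power_add)
    next
      fix j assume j: "j \<in> ?T"
      show "(\<lambda>(J, K). snd (snd (expo J))) (?f j) = j"
        by (simp add: expo_Midx[OF in_range(1)[OF j]])
      show "?f j \<in> ?S"
        unfolding splits_def mem_Collect_eq case_prod_conv expo_Midx[OF in_range(1)[OF j]]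
          expo_Midx[OF in_range(2)[OF j]] I
        using True j by auto
    qed
    \<comment> \<open>Outside \<open>?T\<close> the index exceeds the degree of one of the two
      polynomials, so the sum extends to the full convolution.\<close>
    also have "\<dots> = (\<Sum>j\<le>i3. ?m j)"
    proof (rule sum.mono_neutral_left)
      show "\<forall>j\<in>{..i3} - ?T. ?m j = 0"
      proof
        fix j assume "j \<in> {..i3} - ?T"
        hence "degree (?P a2 a3) < j \<or> degree (?P b2 b3) < i3 - j"
          using degree_subst_poly[of p r a2 q s a3] degree_subst_poly[of p r b2 q s b3] by auto
        thus "?m j = 0" by (auto simp only: coeff_eq_0 mult_zero_left mult_zero_right)
      qed
    qed auto
    also have "\<dots> = l ^ i1 * coeff (?P a2 a3 * ?P b2 b3) i3"
      by (simp only: coeff_mult sum_distrib_left)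
    also have "?P a2 a3 * ?P b2 b3 = ?P (a2 + b2) (a3 + b3)"
      by (simp only: power_add mult_ac)
    finally show ?thesis using True by (simp add: I A B)
  qed
qed

text \<open>Writing binomial coefficients as quotients of factorials cancels all coefficients of the
  coproduct; what remains is the convolution identity \<open>sum_splits_subst_entry\<close>.\<close>

lemma coalgebra_morphism_lin_subst: "coalgebra_morphism (lin_subst l p q r s)"
proof -
  let ?g = "lin_subst l p q r s" and ?h = "subst_entry l p q r s"
  have even: "homogeneous_map 0 ?g"
    by (rule homogeneous_mapI[OF clinear_lin_subst])
      (auto simp: lookup_lin_subst_basis parity_def dest: subst_entry_nonzeroD(1))
  have choose: "of_nat (choose3 (i + j) i) = (of_nat (fact3 (i + j)) / (of_nat (fact3 i) * of_nat (fact3 j)) :: complex)" for i j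
    by (cases i; cases j) (simp add: binomial_fact)
  have fact_nz: "fact3 i \<noteq> 0" for i by (cases i) simp
  have "coproduct (?g v) = tensor_map 0 ?g ?g (coproduct v)" for v
  proof (rule clinear_eqI[where f = "\<lambda>v. coproduct (?g v)"])
    fix I
    show "coproduct (?g (basis I)) = tensor_map 0 ?g ?g (coproduct (basis I))"
    proof (rule poly_mapping_eqI, clarify)
      fix A B
      let ?c = "of_nat (fact3 (expo I)) / (of_nat (fact3 (expo A)) * of_nat (fact3 (expo B))) :: complex"
      have "lookup (tensor_map 0 ?g ?g (coproduct (basis I))) (A, B) =
         (\<Sum>(J, K)\<in>splits I. ?c * (?h (expo J) (expo A) * ?h (expo K) (expo B)))"
        unfolding lookup_tensor_map_coproduct
      proof (intro sum.cong refl, clarify)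
        fix J K assume "(J, K) \<in> splits I"
        hence e: "expo I = expo J + expo K" by (simp add: splits_def)
        show "of_nat (choose3 (expo I) (expo J)) * (- 1) ^ (0 * parity J) * lookup (?g (basis J)) A * lookup (?g (basis K)) B
            = ?c * (?h (expo J) (expo A) * ?h (expo K) (expo B))"
          unfolding e choose lookup_lin_subst_basis by (simp add: fact_nz)
      qed
      also have "\<dots> = ?c * ?h (expo I) (expo A + expo B)"
        unfolding sum_splits_subst_entry[symmetric] by (simp add: sum_distrib_left case_prod_unfold)
      also have "\<dots> = lookup (coproduct (?g (basis I))) (A, B)"
      proof (cases "expo A + expo B \<in> range expo")
        case True
        thus ?thesis
          by (simp add: lookup_coproduct lookup_lin_subst_basis expo_Midx choose fact_nz)
      next
        case False
        \<comment> \<open>Here \<open>A\<close> and \<open>B\<close> both contain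
          \<open>w_1\<close>, so the sum has first exponent 2, whereas that of \<open>I\<close> is
          at most 1.\<close>
        have "?h (expo I) (expo A + expo B) = 0"
        proof (rule ccontr)
          assume "\<not> ?thesis"
          from subst_entry_nonzeroD(1)[OF this] have "fst (expo A + expo B) \<le> 1" using expo_mem(1)[of I] by simp
          with False expo_mem(2)[of A] show False
            unfolding range_expo by (cases "expo A"; cases "expo B") auto
        qed
        thus ?thesis using False by (simp add: lookup_coproduct)
      qed
      finally show "lookup (coproduct (?g (basis I))) (A, B) = lookup (tensor_map 0 ?g ?g (coproduct (basis I))) (A, B)" ..
    qed
  qed (rule clinear_comp[OF clinear_coproduct clinear_lin_subst] clinear_comp[OF clinear_tensor_map clinear_coproduct])+
  with even show ?thesis by (simp add: coalgebra_morphism_def clinear_lin_subst)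
qed

text \<open>Entries between monomials of different degrees vanish, so the map commutes with the
  projection to degree 1.\<close>

lemma to_W_lin_subst: "to_W (lin_subst l p q r s v) = lin_subst l p q r s (to_W v)"
proof (rule clinear_eqI[where f = "\<lambda>v. to_W (lin_subst l p q r s v)"])
  fix I
  have degree: "lookup (lin_subst l p q r s (basis I)) A = 0" if "size3 (expo A) \<noteq> size3 (expo I)" for A
    using that subst_entry_nonzeroD(2)[of l p q r s "expo I" "expo A"]
    unfolding lookup_lin_subst_basis by (metis mult_zero_right)
  have "to_W (basis I) = (if size3 (expo I) = 1 then basis I else 0)" by (simp add: to_W_def)
  thus "to_W (lin_subst l p q r s (basis I)) = lin_subst l p q r s (to_W (basis I))"
    by (auto intro!: poly_mapping_eqI simp: lookup_to_W degree clinear_zero[OF clinear_lin_subst])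
qed (rule clinear_comp[OF clinear_to_W clinear_lin_subst] clinear_comp[OF clinear_lin_subst clinear_to_W])+

section \<open>Monomials of degree 1, and the two quadratic ones on which codifferentials of the
  first kind live\<close>

definition e1 :: midx where "e1 = Midx (1, 0, 0)"
definition e2 :: midx where "e2 = Midx (0, 1, 0)"
definition e3 :: midx where "e3 = Midx (0, 0, 1)"
definition e12 :: midx where "e12 = Midx (1, 1, 0)"
definition e13 :: midx where "e13 = Midx (1, 0, 1)"

lemma expo_e [simp]:
  "expo e1 = (1, 0, 0)" "expo e2 = (0, 1, 0)" "expo e3 = (0, 0, 1)"
  "expo e12 = (1, 1, 0)" "expo e13 = (1, 0, 1)"
  unfolding e1_def e2_def e3_def e12_def e13_def by (rule expo_Midx; simp add: range_expo)+

lemma expo_eq_e: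
  "expo I = (1, 0, 0) \<longleftrightarrow> I = e1" "expo I = (0, 1, 0) \<longleftrightarrow> I = e2" "expo I = (0, 0, 1) \<longleftrightarrow> I = e3"
  "expo I = (1, 1, 0) \<longleftrightarrow> I = e12" "expo I = (1, 0, 1) \<longleftrightarrow> I = e13"
  by (simp_all only: expo_e[symmetric] expo_eq_iff)

lemma e_distinct [simp]:
  "e1 \<noteq> e2" "e1 \<noteq> e3" "e2 \<noteq> e1" "e2 \<noteq> e3" "e3 \<noteq> e1" "e3 \<noteq> e2" "e12 \<noteq> e13" "e13 \<noteq> e12"
  by (auto dest: arg_cong[of _ _ expo])

lemma w_basis: "w 1 = basis e1" "w 2 = basis e2" "w 3 = basis e3"
  by (simp_all add: w_def mon_def range_expo e1_def e2_def e3_def)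

lemma size3_eq_1: "size3 (expo I) = 1 \<longleftrightarrow> I \<in> {e1, e2, e3}"
  unfolding size3_1 by (auto simp: expo_eq_e[symmetric])

lemma comb_w_eq_iff: "x *\<^sub>C w 2 + y *\<^sub>C w 3 = x' *\<^sub>C w 2 + y' *\<^sub>C w 3 \<longleftrightarrow> x = x' \<and> y = y'"
proof
  assume *: "x *\<^sub>C w 2 + y *\<^sub>C w 3 = x' *\<^sub>C w 2 + y' *\<^sub>C w 3"
  show "x = x' \<and> y = y'"
    using arg_cong[OF *, of "\<lambda>v. lookup v e2"] arg_cong[OF *, of "\<lambda>v. lookup v e3"]
    by (simp add: w_basis lookup_add lookup_single)
qed simp

lemma lin_subst_w:
  "lin_subst l p q r s (w 1) = l *\<^sub>C w 1"
  "lin_subst l p q r s (w 2) = p *\<^sub>C w 2 + q *\<^sub>C w 3"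
  "lin_subst l p q r s (w 3) = r *\<^sub>C w 2 + s *\<^sub>C w 3"
proof -
  let ?g = "lin_subst l p q r s"
  have out: "lookup (?g (basis I)) M = 0" if "size3 (expo I) = 1" "M \<notin> {e1, e2, e3}" for I M
  proof -
    have "subst_entry l p q r s (expo I) (expo M) = 0"
      using subst_entry_nonzeroD(2)[of l p q r s "expo I" "expo M"] that size3_eq_1[of M] by auto
    thus ?thesis by (simp add: lookup_lin_subst_basis)
  qed
  show "?g (w 1) = l *\<^sub>C w 1" unfolding w_basis
  proof (rule poly_mapping_eqI)
    fix M show "lookup (?g (basis e1)) M = lookup (l *\<^sub>C basis e1) M"
      using out[of e1 M] by (cases "M \<in> {e1, e2, e3}") (auto simp: lookup_lin_subst_basis lookup_single)
  qed
  show "?g (w 2) = p *\<^sub>C w 2 + q *\<^sub>C w 3" unfolding w_basis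
  proof (rule poly_mapping_eqI)
    fix M show "lookup (?g (basis e2)) M = lookup (p *\<^sub>C basis e2 + q *\<^sub>C basis e3) M"
      using out[of e2 M]
      by (cases "M \<in> {e1, e2, e3}") (auto simp: lookup_lin_subst_basis lookup_single lookup_add when_def)
  qed
  show "?g (w 3) = r *\<^sub>C w 2 + s *\<^sub>C w 3" unfolding w_basis
  proof (rule poly_mapping_eqI)
    fix M show "lookup (?g (basis e3)) M = lookup (r *\<^sub>C basis e2 + s *\<^sub>C basis e3) M"
      using out[of e3 M]
      by (cases "M \<in> {e1, e2, e3}") (auto simp: lookup_lin_subst_basis lookup_single lookup_add when_def)
  qed
qed

text \<open>By uniqueness of morphisms it suffices to check \<open>w_1\<close>, \<open>w_2\<close>,
  \<open>w_3\<close>. The rows are the images of \<open>w_2\<close> and \<open>w_3\<close>, so the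
  hypotheses say that \<open>(p', q'; r', s')\<close> times \<open>(p, q; r, s)\<close> is the
  identity matrix.\<close>

lemma lin_subst_inverse:
  assumes "l * l' = 1" "p' * p + q' * r = 1" "p' * q + q' * s = 0" "r' * p + s' * r = 0" "r' * q + s' * s = 1"
  shows "lin_subst l p q r s (lin_subst l' p' q' r' s' v) = v"
proof (rule coalgebra_morphism_unique[OF coalgebra_morphism_comp[OF coalgebra_morphism_lin_subst
      coalgebra_morphism_lin_subst] coalgebra_morphism_id])
  fix I
  let ?g = "lin_subst l p q r s" and ?h = "lin_subst l' p' q' r' s'"
  have g: "?g (u + v) = ?g u + ?g v" "?g (c *\<^sub>C v) = c *\<^sub>C ?g v" for u v c
    using clinear_lin_subst[of l p q r s] by (simp_all add: clinear_iff)
  have "?g (?h (w 1)) = w 1" by (simp add: lin_subst_w g assms mult.commute del: One_nat_def)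
  moreover have "?g (?h (w 2)) = (p' * p + q' * r) *\<^sub>C w 2 + (p' * q + q' * s) *\<^sub>C w 3"
    "?g (?h (w 3)) = (r' * p + s' * r) *\<^sub>C w 2 + (r' * q + s' * s) *\<^sub>C w 3"
    by (simp_all add: lin_subst_w g poly_mapping.scale_left_distrib poly_mapping.scale_right_distrib)
  ultimately have "?g (?h (basis I)) = basis I" if "size3 (expo I) = 1"
    using that unfolding size3_eq_1 by (auto simp: w_basis assms simp del: One_nat_def)
  moreover have "to_W (basis I) = (if size3 (expo I) = 1 then basis I else 0)" by (simp add: to_W_def)
  ultimately show "to_W (?g (?h (basis I))) = to_W (basis I)"
    by (simp add: to_W_lin_subst clinear_zero[OF clinear_lin_subst])
qed

subsection \<open>Codifferentials of the first kind\<close>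

lemma first_kind_eq: "first_kind x a b c v =
    lookup v e12 *\<^sub>C (x *\<^sub>C w 2 + a *\<^sub>C w 3) + lookup v e13 *\<^sub>C (b *\<^sub>C w 2 + c *\<^sub>C w 3)"
proof -
  have phi: "phi (expo P) j v = (of_nat (fact3 (expo P)) * lookup v P) *\<^sub>C w j" for P j
  proof (rule poly_mapping_eqI)
    fix M
    have "lookup (phi (expo P) j v) M = (\<Sum>I\<in>Poly_Mapping.keys v.
       if I = P then of_nat (fact3 (expo P)) * lookup v P * lookup (w j) M else 0)"
      unfolding phi_def lookup_extend by (intro sum.cong) auto
    thus "lookup (phi (expo P) j v) M = lookup ((of_nat (fact3 (expo P)) * lookup v P) *\<^sub>C w j) M"
      by (simp add: in_keys_iff)
  qed
  have "psi (1, 1, 0) j v = lookup v e12 *\<^sub>C w j" "psi (1, 0, 1) j v = lookup v e13 *\<^sub>C w j" for j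
    using phi[of e12 j] phi[of e13 j] by simp_all
  thus ?thesis by (simp add: first_kind_def poly_mapping.scale_right_distrib mult_ac add_ac)
qed

lemma canonical_first_kind:
  "d_star = first_kind 0 1 0 0" "d_sharp = first_kind 1 1 0 1" "d_c z = first_kind 1 0 0 z"
  unfolding d_star_def d_sharp_def d_c_def first_kind_def by auto

lemma lookup_first_kind: "lookup (first_kind x a b c v) M =
  (if M = e2 then x * lookup v e12 + b * lookup v e13
   else if M = e3 then a * lookup v e12 + c * lookup v e13 else 0)"
  by (auto simp: first_kind_eq w_basis lookup_add lookup_single when_def)

lemma clinear_first_kind: "clinear (first_kind x a b c)"
  unfolding clinear_iff
  by (auto intro!: poly_mapping_eqI simp: lookup_first_kind lookup_add algebra_simps)

lemma first_kind_in_L: "first_kind x a b c \<in> L"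
  unfolding L_def using clinear_first_kind by (auto simp: in_W_iff lookup_first_kind)

lemma first_kind_odd: "homogeneous_map 1 (first_kind x a b c)"
  by (rule homogeneous_mapI[OF clinear_first_kind])
    (auto simp: lookup_first_kind lookup_single when_def parity_def split: if_splits)

text \<open>The coderivation replaces a factor \<open>w_1 w_2\<close> or \<open>w_1 w_3\<close> by a
  combination of \<open>w_2\<close> and \<open>w_3\<close>: it removes \<open>w_1\<close> and lowers
  the degree by one.\<close>

lemma coder_first_kind_nonzeroD:
  assumes "lookup (coder (first_kind x a b c) (basis I)) M \<noteq> 0"
  shows "size3 (expo I) = size3 (expo M) + 1" "parity I = 1" "parity M = 0"
proof -
  let ?d = "first_kind x a b c"
  obtain P j where *: "j \<in> {1, 2, 3}" "lookup (?d (basis P)) (Midx (unit3 j)) * elem P j I M \<noteq> 0"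
    using assms unfolding lookup_coder[OF first_kind_in_L finite_below[of I] order.refl]
    by (meson sum.neutral)
  hence P: "P \<in> {e12, e13}" and j: "j \<in> {2, 3}"
    using expo_Midx[OF unit3_range[of 1]]
    by (auto simp: lookup_first_kind lookup_single when_def e2_def[symmetric] e3_def[symmetric] e1_def[symmetric] split: if_splits)
  have e: "expo M + expo P = expo I + unit3 j" using *(2) by (auto simp: elem_def split: if_splits)
  have i: "fst (expo I) \<le> 1" by (rule expo_mem)
  obtain m1 m2 m3 where M: "expo M = (m1, m2, m3)" by (cases "expo M")
  obtain i1 i2 i3 where I: "expo I = (i1, i2, i3)" by (cases "expo I")
  show "size3 (expo I) = size3 (expo M) + 1" "parity I = 1" "parity M = 0"
    using P j e i by (auto simp: M I parity_def)
qed

text \<open>The image of the coderivation consists of terms without \<open>w_1\<close>, and these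
  are sent to 0, so the square vanishes. For odd parity the graded commutator is twice the
  square.\<close>

lemma codifferential_first_kind: "codifferential (first_kind x a b c)"
proof -
  let ?D = "coder (first_kind x a b c)"
  have lin: "clinear ?D" by (rule clinear_coder[OF first_kind_in_L])
  have "?D (?D v) = 0" for v
  proof (rule clinear_eqI[where f = "\<lambda>v. ?D (?D v)" and g = "\<lambda>v. 0"])
    fix I
    have "?D (basis J) = 0" if "J \<in> Poly_Mapping.keys (?D (basis I))" for J
    proof (rule poly_mapping_eqI)
      fix M
      have "parity J = 0" using that coder_first_kind_nonzeroD(3) by (auto simp: in_keys_iff)
      thus "lookup (?D (basis J)) M = lookup 0 M"
        using coder_first_kind_nonzeroD(2)[of x a b c J M] by auto
    qed
    thus "?D (?D (basis I)) = 0"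
      by (subst clinear_eq_extend[OF lin]) (simp add: extend_def)
  qed (use clinear_comp[OF lin lin] in \<open>auto simp: clinear_iff\<close>)
  thus ?thesis
    by (simp add: codifferential_def first_kind_in_L first_kind_odd gcommutator_def del: One_nat_def)
qed

text \<open>With \<open>B = (p, q; r, s)\<close>, \<open>A = (x, a; b, c)\<close> and rows as
  images, the four equations read \<open>l B A = A' B\<close>. They express that
  \<open>d g = g d'\<close> for the linear substitution \<open>g\<close> given by \<open>l\<close>
  and \<open>B\<close>.\<close>

lemma first_kind_equivalentI:
  assumes "l \<noteq> 0" "p * s - q * r \<noteq> 0"
    and "l * (p * x + q * b) = x' * p + a' * r" "l * (p * a + q * c) = x' * q + a' * s"
    and "l * (r * x + s * b) = b' * p + c' * r" "l * (r * a + s * c) = b' * q + c' * s"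
  shows "first_kind x a b c \<approx> first_kind x' a' b' c'"
proof -
  let ?d = "first_kind x a b c" and ?d' = "first_kind x' a' b' c'"
  define t where "t = p * s - q * r"
  have t: "t \<noteq> 0" using assms(2) by (simp add: t_def)
  define g where "g = lin_subst l p q r s"
  \<comment> \<open>The inverse of the 2 x 2 matrix is its adjugate divided by the
    determinant.\<close>
  define h where "h = lin_subst (1 / l) (s / t) (- q / t) (- r / t) (p / t)"
  have mor: "coalgebra_morphism g" "coalgebra_morphism h"
    by (simp_all add: g_def h_def coalgebra_morphism_lin_subst)
  have "g (h v) = v" for v
    unfolding g_def h_def
    by (rule lin_subst_inverse) (use assms(1) t in \<open>auto simp: field_simps, auto simp: t_def algebra_simps\<close>)
  moreover have hg: "h (g v) = v" for v
    unfolding g_def h_def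
    by (rule lin_subst_inverse) (use assms(1) t in \<open>auto simp: field_simps, auto simp: t_def algebra_simps\<close>)
  ultimately have inv: "bij g" "inv g = h"
    by (metis bijI' , metis inv_equality)
  have dg: "?d (g v) = g (?d' v)" for v
  proof (rule clinear_eqI[where f = "\<lambda>v. ?d (g v)"])
    show "clinear (\<lambda>v. ?d (g v))" "clinear (\<lambda>v. g (?d' v))"
      unfolding g_def by (rule clinear_comp[OF clinear_first_kind clinear_lin_subst]
          clinear_comp[OF clinear_lin_subst clinear_first_kind])+
  next
    fix I
    have lin: "g (u + v) = g u + g v" "g (k *\<^sub>C v) = k *\<^sub>C g v" for u v k
      using clinear_lin_subst[of l p q r s] by (simp_all add: clinear_iff g_def)
    have gw: "g (w 2) = p *\<^sub>C w 2 + q *\<^sub>C w 3" "g (w 3) = r *\<^sub>C w 2 + s *\<^sub>C w 3"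
      by (simp_all add: g_def lin_subst_w)
    have comb: "g (y *\<^sub>C w 2 + z *\<^sub>C w 3) = (y * p + z * r) *\<^sub>C w 2 + (y * q + z * s) *\<^sub>C w 3" for y z
      by (simp add: lin gw poly_mapping.scale_left_distrib poly_mapping.scale_right_distrib)
    have comb': "y *\<^sub>C (x *\<^sub>C w 2 + a *\<^sub>C w 3) + z *\<^sub>C (b *\<^sub>C w 2 + c *\<^sub>C w 3)
        = (y * x + z * b) *\<^sub>C w 2 + (y * a + z * c) *\<^sub>C w 3" for y z
      by (simp add: poly_mapping.scale_left_distrib poly_mapping.scale_right_distrib)
    consider "I = e12" | "I = e13" | "I \<noteq> e12" "I \<noteq> e13" by blast
    thus "?d (g (basis I)) = g (?d' (basis I))"
    proof cases
      case 1
      have "lookup (g (basis e12)) e12 = l * p" "lookup (g (basis e12)) e13 = l * q"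
        by (simp_all add: g_def lookup_lin_subst_basis)
      thus ?thesis using assms(3,4) unfolding 1 first_kind_eq comb'
        by (simp add: lookup_single comb comb_w_eq_iff) (simp add: algebra_simps)
    next
      case 2
      have "lookup (g (basis e13)) e12 = l * r" "lookup (g (basis e13)) e13 = l * s"
        by (simp_all add: g_def lookup_lin_subst_basis)
      thus ?thesis using assms(5,6) unfolding 2 first_kind_eq comb'
        by (simp add: lookup_single comb comb_w_eq_iff) (simp add: algebra_simps)
    next
      case 3
      \<comment> \<open>The substitution preserves the degree and the exponent of
        \<open>w_1\<close>, so no other monomial reaches \<open>w_1 w_2\<close> or
        \<open>w_1 w_3\<close>; both sides vanish.\<close>
      have "lookup (g (basis I)) M = 0" if M: "M \<in> {e12, e13}" for M
      proof (rule ccontr)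
        assume "\<not> ?thesis"
        hence "subst_entry l p q r s (expo I) (expo M) \<noteq> 0" by (auto simp: g_def lookup_lin_subst_basis)
        from subst_entry_nonzeroD[OF this] have "fst (expo I) = 1" "size3 (expo I) = 2" using M by auto
        moreover obtain i1 i2 i3 where "expo I = (i1, i2, i3)" by (cases "expo I")
        ultimately have "expo I = (1, 1, 0) \<or> expo I = (1, 0, 1)" by auto
        thus False using 3 by (simp only: expo_eq_e) simp
      qed
      thus ?thesis using 3 lin(2)[of 0 0] by (simp add: first_kind_eq lookup_single)
    qed
  qed
  have "coderivation 1 (coder ?d)" "coderivation 1 (coder ?d')"
    by (rule coder_coderivation[OF first_kind_in_L first_kind_odd])+
  \<comment> \<open>Coderivations are determined by their components in \<open>W\<close>, so
    \<open>d g = g d'\<close> lifts to all of \<open>S(W)\<close>.\<close>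
  hence "(\<lambda>v. h (coder ?d (g v))) = coder ?d'"
  proof (intro coderivation_unique[OF coderivation_conj[OF _ mor hg]])
    fix v
    have "to_W (h (coder ?d (g v))) = h (?d (g v))"
      by (simp add: h_def to_W_lin_subst to_W_coder[OF first_kind_in_L])
    thus "to_W (h (coder ?d (g v))) = to_W (coder ?d' v)"
      by (simp add: dg hg to_W_coder[OF first_kind_in_L])
  qed
  hence "coder ?d' = inv g \<circ> coder ?d \<circ> g" unfolding inv comp_def by (rule sym)
  moreover have "coalgebra_automorphism g"
    using mor(1) inv(1) by (simp add: coalgebra_automorphism_def coalgebra_morphism_def)
  ultimately show ?thesis unfolding equivalent_def using codifferential_first_kind by blast
qed

section \<open>Matrix equations forced by an equivalence\<close>

lemma splits_e1j: "splits e12 = {(e1, e2), (e2, e1)}" "splits e13 = {(e1, e3), (e3, e1)}"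
proof -
  have "(J, K) \<in> splits e12 \<longleftrightarrow> (J, K) \<in> {(e1, e2), (e2, e1)}" for J K
    using expo_mem[of J] expo_mem[of K]
    by (cases "expo J"; cases "expo K") (auto simp: splits_def expo_eq_e[symmetric] add_is_1)
  moreover have "(J, K) \<in> splits e13 \<longleftrightarrow> (J, K) \<in> {(e1, e3), (e3, e1)}" for J K
    using expo_mem[of J] expo_mem[of K]
    by (cases "expo J"; cases "expo K") (auto simp: splits_def expo_eq_e[symmetric] add_is_1)
  ultimately show "splits e12 = {(e1, e2), (e2, e1)}" "splits e13 = {(e1, e3), (e3, e1)}" by auto
qed

text \<open>
  As \<open>d\<close> is concentrated in degree \<open>2\<close>, comparing the two sides on \<open>w_1 w_2\<close> and \<open>w_1 w_3\<close>
  only involves the linear part of the automorphism.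
\<close>

lemma first_kind_equivalentD:
  assumes "first_kind x a b c \<approx> first_kind x' a' b' c'"
  obtains l p q r s where "l \<noteq> 0" "p * s - q * r \<noteq> 0"
    "l * (p * x + q * b) = x' * p + a' * r" "l * (p * a + q * c) = x' * q + a' * s"
    "l * (r * x + s * b) = b' * p + c' * r" "l * (r * a + s * c) = b' * q + c' * s"
proof -
  let ?d = "first_kind x a b c" and ?d' = "first_kind x' a' b' c'"
  obtain g where g: "coalgebra_automorphism g" and eq: "coder ?d' = inv g \<circ> coder ?d \<circ> g"
    using assms by (auto simp: equivalent_def)
  have lin: "clinear g" and bij: "bij g" and even: "homogeneous_map 0 g"
    and cp: "coproduct (g v) = tensor_map 0 g g (coproduct v)" for v
    using g by (auto simp: coalgebra_automorphism_def)
  have g_add: "g (u + v) = g u + g v" and g_scale: "g (k *\<^sub>C v) = k *\<^sub>C g v" for u v k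
    using lin by (auto simp: clinear_iff)
  have g_eq_0: "g v = 0 \<longleftrightarrow> v = 0" for v
    using clinear_zero[OF lin] bij by (metis bij_pointE)
  define l p q r s where "l = lookup (g (w 1)) e1" and "p = lookup (g (w 2)) e2" and "q = lookup (g (w 2)) e3"
    and "r = lookup (g (w 3)) e2" and "s = lookup (g (w 3)) e3"
  have parity_e: "parity e1 = 1" "parity e2 = 0" "parity e3 = 0" by (simp_all add: parity_def)
  have zero: "lookup (g (basis I)) M = 0" if "odd (parity I + parity M)" for I M
    using homogeneous_mapD[OF even, of I M] that by auto
  \<comment> \<open>\<open>W\<close> consists of the elements with zero coproduct, a property
    preserved by \<open>g\<close>.\<close>
  have in_W: "g (basis I) \<in> W" if "size3 (expo I) = 1" for I
  proof (rule coproduct_eq_0_imp_W)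
    have "coproduct (basis I) = 0"
    proof (rule poly_mapping_eqI, clarify)
      fix A B
      have "expo A + expo B \<noteq> expo I"
      proof
        assume "expo A + expo B = expo I"
        from arg_cong[OF this, of size3] show False
          using that size3_pos[of A] size3_pos[of B] by (simp add: size3_add)
      qed
      thus "lookup (coproduct (basis I)) (A, B) = lookup 0 (A, B)" by (simp add: lookup_coproduct_basis)
    qed
    thus "coproduct (g (basis I)) = 0" unfolding cp by (simp add: clinear_zero[OF clinear_tensor_map])
  qed
  have expand: "v = lookup v e1 *\<^sub>C w 1 + (lookup v e2 *\<^sub>C w 2 + lookup v e3 *\<^sub>C w 3)" if "v \<in> W" for v
    using W_expand[OF that] by (simp add: e1_def e2_def e3_def)
  have gw: "g (w 1) = l *\<^sub>C w 1" "g (w 2) = p *\<^sub>C w 2 + q *\<^sub>C w 3" "g (w 3) = r *\<^sub>C w 2 + s *\<^sub>C w 3"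
    using expand[OF in_W[of e1]] expand[OF in_W[of e2]] expand[OF in_W[of e3]]
      zero[of e1 e2] zero[of e1 e3] zero[of e2 e1] zero[of e3 e1]
    unfolding l_def p_def q_def r_def s_def w_basis by (simp_all add: parity_e)
  have comb: "g (y *\<^sub>C w 2 + z *\<^sub>C w 3) = (y * p + z * r) *\<^sub>C w 2 + (y * q + z * s) *\<^sub>C w 3" for y z
    by (simp add: g_add g_scale gw poly_mapping.scale_left_distrib poly_mapping.scale_right_distrib)
  have comb': "y *\<^sub>C (x *\<^sub>C w 2 + a *\<^sub>C w 3) + z *\<^sub>C (b *\<^sub>C w 2 + c *\<^sub>C w 3)
      = (y * x + z * b) *\<^sub>C w 2 + (y * a + z * c) *\<^sub>C w 3" for x a b c y z
    by (simp add: poly_mapping.scale_left_distrib poly_mapping.scale_right_distrib)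
  have "w 1 \<noteq> 0"
    unfolding w_basis by (metis lookup_single_eq lookup_zero zero_neq_one)
  hence "l \<noteq> 0" using gw(1) g_eq_0[of "w 1"] by auto
  moreover have "p * s - q * r \<noteq> 0"
  proof
    assume det: "p * s - q * r = 0"
    have kernel: "y = 0 \<and> z = 0" if "y * p + z * r = 0" "y * q + z * s = 0" for y z
      using comb_w_eq_iff[of y z 0 0] g_eq_0[of "y *\<^sub>C w 2 + z *\<^sub>C w 3"] by (simp add: comb that)
    \<comment> \<open>If the determinant vanishes, \<open>(s, - q)\<close> and
      \<open>(r, - p)\<close> are linear relations between the rows. Injectivity of \<open>g\<close>
      makes all entries 0, and then \<open>(1, 0)\<close> is a nontrivial relation.\<close>
    have "s = 0 \<and> - q = 0" by (rule kernel) (use det in \<open>simp_all add: algebra_simps\<close>)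
    moreover have "r = 0 \<and> - p = 0" by (rule kernel) (use det in \<open>simp_all add: algebra_simps\<close>)
    ultimately show False using kernel[of 1 0] by simp
  qed
  \<comment> \<open>On degree 2 the coderivation of \<open>d'\<close> lands in \<open>W\<close>, so
    it equals \<open>d'\<close> there. Projecting the intertwining relation to \<open>W\<close>
    replaces the other coderivation by \<open>d\<close>.\<close>
  moreover have key: "g (?d' (basis I)) = ?d (g (basis I))" if "size3 (expo I) = 2" for I
  proof -
    have to_W: "to_W v = v" if "v \<in> W" for v
      using that by (auto intro!: poly_mapping_eqI simp: lookup_to_W in_W_iff)
    have "coder ?d' (basis I) \<in> W"
      using coder_first_kind_nonzeroD(1)[of x' a' b' c' I] that by (force simp: in_W_iff)
    hence "coder ?d' (basis I) = ?d' (basis I)"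
      using to_W to_W_coder[OF first_kind_in_L] by metis
    hence "g (?d' (basis I)) = coder ?d (g (basis I))"
      using eq bij by (metis bij_inv_eq_iff comp_apply)
    moreover have "g (?d' (basis I)) \<in> W"
      unfolding first_kind_eq comb' comb by (auto simp: in_W_iff w_basis lookup_add lookup_single when_def)
    ultimately show ?thesis using to_W to_W_coder[OF first_kind_in_L] by metis
  qed
  \<comment> \<open>The coefficient at \<open>w_1 w_j\<close> is read off from the coproduct at
    \<open>w_1\<close> tensor \<open>w_j\<close>. The splitting in the opposite order contributes
    nothing, as \<open>g\<close> is even.\<close>
  have prod: "lookup (g (basis e12)) e12 = l * p" "lookup (g (basis e12)) e13 = l * q"
    "lookup (g (basis e13)) e12 = l * r" "lookup (g (basis e13)) e13 = l * s"
  proof -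
    have cop: "lookup (coproduct v) (e1, e2) = lookup v e12" "lookup (coproduct v) (e1, e3) = lookup v e13" for v
      by (simp_all add: lookup_coproduct range_expo e12_def e13_def)
    show "lookup (g (basis e12)) e12 = l * p" "lookup (g (basis e12)) e13 = l * q"
      "lookup (g (basis e13)) e12 = l * r" "lookup (g (basis e13)) e13 = l * s"
      unfolding cop[symmetric] cp lookup_tensor_map_coproduct splits_e1j l_def p_def q_def r_def s_def w_basis
      by (simp_all add: zero parity_e)
  qed
  have "l * (p * x + q * b) = x' * p + a' * r" "l * (p * a + q * c) = x' * q + a' * s"
  proof -
    have "g (x' *\<^sub>C w 2 + a' *\<^sub>C w 3) = (l * p * x + l * q * b) *\<^sub>C w 2 + (l * p * a + l * q * c) *\<^sub>C w 3"
      using key[of e12] by (simp add: first_kind_eq prod comb' lookup_single)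
    thus "l * (p * x + q * b) = x' * p + a' * r" "l * (p * a + q * c) = x' * q + a' * s"
      unfolding comb comb_w_eq_iff by (simp_all add: algebra_simps)
  qed
  moreover have "l * (r * x + s * b) = b' * p + c' * r" "l * (r * a + s * c) = b' * q + c' * s"
  proof -
    have "g (b' *\<^sub>C w 2 + c' *\<^sub>C w 3) = (l * r * x + l * s * b) *\<^sub>C w 2 + (l * r * a + l * s * c) *\<^sub>C w 3"
      using key[of e13] by (simp add: first_kind_eq prod comb' lookup_single)
    thus "l * (r * x + s * b) = b' * p + c' * r" "l * (r * a + s * c) = b' * q + c' * s"
      unfolding comb comb_w_eq_iff by (simp_all add: algebra_simps)
  qed
  ultimately show ?thesis by (rule that)
qed

subsection \<open>Normal forms\<close>

text \<open>Up to conjugation \<open>A'\<close> is \<open>l A\<close>, so the trace scales by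
  \<open>l\<close> and the determinant by its square.\<close>

lemma first_kind_equivalent_invariants:
  assumes "first_kind x a b c \<approx> first_kind x' a' b' c'"
  obtains l where "l \<noteq> 0" "x' + c' = l * (x + c)" "x' * c' - a' * b' = l\<^sup>2 * (x * c - a * b)"
proof -
  obtain l p q r s where l: "l \<noteq> 0" and t: "p * s - q * r \<noteq> 0" and
    R: "l * (p * x + q * b) = x' * p + a' * r" "l * (p * a + q * c) = x' * q + a' * s"
      "l * (r * x + s * b) = b' * p + c' * r" "l * (r * a + s * c) = b' * q + c' * s"
    by (rule first_kind_equivalentD[OF assms])
  \<comment> \<open>The right-hand side is the trace of \<open>A' B\<close> times the adjugate of
    \<open>B\<close>.\<close>
  have "(p * s - q * r) * (x' + c')
      = s * (x' * p + a' * r) - r * (x' * q + a' * s) + p * (b' * q + c' * s) - q * (b' * p + c' * r)"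
    by (simp add: algebra_simps)
  also have "\<dots> = (p * s - q * r) * (l * (x + c))"
    unfolding R[symmetric] by (simp add: algebra_simps)
  finally have trace: "x' + c' = l * (x + c)" using t by simp
  have "(p * s - q * r) * (x' * c' - a' * b')
      = (x' * p + a' * r) * (b' * q + c' * s) - (x' * q + a' * s) * (b' * p + c' * r)"
    by (simp add: algebra_simps)
  also have "\<dots> = (p * s - q * r) * (l\<^sup>2 * (x * c - a * b))"
    unfolding R[symmetric] by (simp add: algebra_simps power2_eq_square)
  finally have det: "x' * c' - a' * b' = l\<^sup>2 * (x * c - a * b)" using t by simp
  show ?thesis by (rule that[OF l trace det])
qed

section \<open>Reduction to Jordan form\<close>

lemma singular_2x2_kernel:
  fixes m11 :: complex
  assumes "m11 * m22 = m12 * m21"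
  obtains u v where "u \<noteq> 0 \<or> v \<noteq> 0" "u * m11 + v * m12 = 0" "u * m21 + v * m22 = 0"
proof (cases "m11 = 0 \<and> m12 = 0")
  case True
  show ?thesis
  proof (cases "m21 = 0 \<and> m22 = 0")
    case True
    with \<open>m11 = 0 \<and> m12 = 0\<close> show ?thesis by (intro that[of 1 0]) auto
  next
    case False
    with \<open>m11 = 0 \<and> m12 = 0\<close> show ?thesis by (intro that[of "- m22" m21]) (auto simp: mult.commute)
  qed
next
  case False
  \<comment> \<open>The vector is orthogonal to the nonzero first row, and the second row is
    proportional to the first.\<close>
  with assms show ?thesis by (intro that[of "- m12" m11]) (auto simp: mult.commute)
qed

text \<open>By trace and determinant, \<open>m\<close> and \<open>n\<close> are the eigenvalues.
  Left eigenvectors \<open>(p, q)\<close> and \<open>(r, s)\<close> serve as the rows of the base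
  change, and the factor \<open>1 / m\<close> turns the eigenvalues into 1 and
  \<open>n / m\<close>.\<close>

lemma equivalent_d_c_if_distinct_eigenvalues:
  assumes "m \<noteq> n" "m \<noteq> 0" "m + n = x + c" "m * n = x * c - a * b"
  shows "first_kind x a b c \<approx> d_c (n / m)"
proof -
  have n: "n = x + c - m" using assms(3) by (simp add: algebra_simps)
  have char: "(x - m) * (c - m) = b * a" "(x - n) * (c - n) = b * a"
    using assms(4) unfolding n by algebra+
  obtain p q where pq: "p \<noteq> 0 \<or> q \<noteq> 0" "p * (x - m) + q * b = 0" "p * a + q * (c - m) = 0"
    by (rule singular_2x2_kernel[OF char(1)])
  obtain r s where rs: "r \<noteq> 0 \<or> s \<noteq> 0" "r * (x - n) + s * b = 0" "r * a + s * (c - n) = 0"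
    by (rule singular_2x2_kernel[OF char(2)])
  have R: "p * x + q * b = m * p" "p * a + q * c = m * q" "r * x + s * b = n * r" "r * a + s * c = n * s"
    using pq rs by (simp_all add: algebra_simps)
  have "p * s - q * r \<noteq> 0"
  proof
    assume "p * s - q * r = 0"
    \<comment> \<open>Proportional eigenvectors with different eigenvalues: together with
      \<open>p s = q r\<close>, the two vanishing products make one of them zero.\<close>
    hence "(n - m) * (r * p) = 0" "(n - m) * (s * q) = 0" using R by algebra+
    hence "r * p = 0" "s * q = 0" using assms(1) by auto
    with \<open>p * s - q * r = 0\<close> pq(1) rs(1) show False by auto
  qed
  thus ?thesis unfolding canonical_first_kind
    by (intro first_kind_equivalentI[of "1 / m" p s q r]) (use assms(2) in \<open>simp_all add: R\<close>)
qed

text \<open>The matrix \<open>N = A - m\<close> has square 0 and, by the last hypothesis, is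
  nonzero. A row vector \<open>(p, q)\<close> independent of its image \<open>(r, s)\<close> under
  \<open>N\<close> gives a Jordan basis. For nonzero \<open>m\<close>, scaling by
  \<open>1 / m\<close> and dividing \<open>(r, s)\<close> by \<open>m\<close> makes both the
  eigenvalue and the off-diagonal entry 1.\<close>

lemma equivalent_if_double_eigenvalue:
  assumes "2 * m = x + c" "m * m = x * c - a * b" "a \<noteq> 0 \<or> b \<noteq> 0"
  shows "first_kind x a b c \<approx> (if m = 0 then d_star else d_sharp)"
proof -
  \<comment> \<open>The determinant of \<open>(p, q)\<close> and its image is \<open>a\<close> for
    \<open>(1, 0)\<close> and \<open>- b\<close> for \<open>(0, 1)\<close>.\<close>
  obtain p q where pq: "p * (p * a + q * (c - m)) - q * (p * (x - m) + q * b) \<noteq> 0"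
  proof (cases "a = 0")
    case True thus ?thesis using assms(3) that[of 0 1] by simp
  next
    case False thus ?thesis using that[of 1 0] by simp
  qed
  define r s where "r = p * (x - m) + q * b" and "s = p * a + q * (c - m)"
  have x: "x = 2 * m - c" using assms(1) by (simp add: algebra_simps)
  have nil: "r * (x - m) + s * b = 0" "r * a + s * (c - m) = 0"
    using assms(2) unfolding r_def s_def x by algebra+
  have R: "p * x + q * b = m * p + r" "p * a + q * c = m * q + s" "r * x + s * b = m * r" "r * a + s * c = m * s"
    using nil by (simp_all add: r_def s_def algebra_simps)
  have t: "p * s - q * r \<noteq> 0" using pq by (simp add: r_def s_def)
  show ?thesis
  proof (cases "m = 0")
    case True
    have "first_kind x a b c \<approx> first_kind 0 1 0 0"
      by (rule first_kind_equivalentI[of 1 p s q r]) (use t True in \<open>simp_all add: R\<close>)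
    thus ?thesis using True by (simp add: canonical_first_kind)
  next
    case False
    have R': "r * x / m + s * b / m = r" "r * a / m + s * c / m = s"
      using False by (simp_all add: R add_divide_distrib[symmetric])
    have "first_kind x a b c \<approx> first_kind 1 1 0 1"
      by (rule first_kind_equivalentI[of "1 / m" p "s / m" q "r / m"])
        (use t False in \<open>simp_all add: R R' add_divide_distrib diff_divide_distrib[symmetric]\<close>)
    thus ?thesis using False by (simp add: canonical_first_kind)
  qed
qed

lemma first_kind_normal_form:
  assumes "first_kind x a b c \<noteq> (\<lambda>v. 0)"
  shows "first_kind x a b c \<approx> d_star \<or> first_kind x a b c \<approx> d_sharp \<or> (\<exists>z. first_kind x a b c \<approx> d_c z)"
proof -
  \<comment> \<open>The radicand is the discriminant of the characteristic polynomial;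
    \<open>m\<close> and \<open>n\<close> are its roots.\<close>
  define t where "t = csqrt ((x - c)\<^sup>2 + 4 * a * b)"
  define m n where "m = (x + c + t) / 2" and "n = (x + c - t) / 2"
  have sum: "m + n = x + c" by (simp add: m_def n_def field_simps)
  have "t\<^sup>2 = (x - c)\<^sup>2 + 4 * a * b" by (simp add: t_def)
  hence prod: "m * n = x * c - a * b" unfolding m_def n_def by (simp add: field_simps power2_eq_square)
  \<comment> \<open>Of two distinct eigenvalues at least one is nonzero and can be scaled to
    1.\<close>
  consider "m \<noteq> n" "m \<noteq> 0" | "m \<noteq> n" "n \<noteq> 0" | "m = n" by fastforce
  thus ?thesis
  proof cases
    case 1 thus ?thesis using equivalent_d_c_if_distinct_eigenvalues sum prod by blast
  next
    case 2
    thus ?thesis using equivalent_d_c_if_distinct_eigenvalues[of n m] sum prod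
      by (metis add.commute mult.commute)
  next
    case 3
    hence mm: "2 * m = x + c" "m * m = x * c - a * b" using sum prod by auto
    show ?thesis
    proof (cases "a = 0 \<and> b = 0")
      case True
      \<comment> \<open>A diagonal matrix with a double eigenvalue is scalar, which leads to
        \<open>d_c 1\<close>.\<close>
      have "(x - c)\<^sup>2 = 0" using mm True by algebra
      hence eq: "x = c" by simp
      have "x \<noteq> 0"
        using assms True eq by (auto simp: first_kind_def)
      hence "first_kind x a b c \<approx> d_c 1" unfolding canonical_first_kind
        by (intro first_kind_equivalentI[of "1 / x" 1 1 0 0]) (use True eq in auto)
      thus ?thesis by blast
    next
      case False
      thus ?thesis using equivalent_if_double_eigenvalue[OF mm] by (auto split: if_splits)
    qed
  qed
qed

section \<open>Separating the normal forms\<close>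

lemma d_c_equivalent_iff: "d_c z \<approx> d_c z' \<longleftrightarrow> z' = z \<or> (z \<noteq> 0 \<and> z' = inverse z)"
proof
  assume "d_c z \<approx> d_c z'"
  then obtain l where l: "l \<noteq> 0" "1 + z' = l * (1 + z)" "z' = l\<^sup>2 * z"
    unfolding canonical_first_kind by (rule first_kind_equivalent_invariants) simp
  \<comment> \<open>Eliminating \<open>z'\<close> from the trace and determinant conditions leaves
    this factorization: either \<open>l = 1\<close>, or \<open>l\<close> is the inverse of
    \<open>z\<close>.\<close>
  have "(1 - l) * (1 - l * z) = 0" using l(2,3) by algebra
  thus "z' = z \<or> (z \<noteq> 0 \<and> z' = inverse z)"
  proof (elim mult_eq_0_iff[THEN iffD1, THEN disjE])
    assume "1 - l = 0" thus ?thesis using l(3) by simp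
  next
    assume "1 - l * z = 0"
    hence "z * l = 1" by (simp add: mult.commute)
    moreover from this have "z' = l" using l(3) by (simp add: power2_eq_square mult.assoc mult.commute)
    ultimately show ?thesis using inverse_unique[of z l] by auto
  qed
next
  assume "z' = z \<or> (z \<noteq> 0 \<and> z' = inverse z)"
  thus "d_c z \<approx> d_c z'"
  proof
    assume "z' = z"
    thus ?thesis unfolding canonical_first_kind by (intro first_kind_equivalentI[of 1 1 1 0 0]) auto
  next
    assume "z \<noteq> 0 \<and> z' = inverse z"
    \<comment> \<open>Exchange \<open>w_2\<close> and \<open>w_3\<close> and rescale by the inverse
      of \<open>z\<close>.\<close>
    thus ?thesis unfolding canonical_first_kind
      by (intro first_kind_equivalentI[of "inverse z" 0 0 1 1]) auto
  qed
qed

text \<open>Trace and determinant do not distinguish \<open>d_sharp\<close> from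
  \<open>d_c 1\<close>, so the full matrix equations are used. Both rows of the base change would be
  left eigenvectors of a Jordan block, hence multiples of \<open>(0, 1)\<close>, contradicting
  invertibility.\<close>

lemma not_d_sharp_equivalent_d_c: "\<not> d_sharp \<approx> d_c z"
proof
  assume "d_sharp \<approx> d_c z"
  then obtain l p q r s where "l \<noteq> 0" "p * s - q * r \<noteq> 0"
    "l * p = p" "l * (p + q) = q" "l * r = z * r" "l * (r + s) = z * s"
    unfolding canonical_first_kind by (rule first_kind_equivalentD) simp
  thus False by (cases "p = 0"; cases "r = 0") (auto simp: distrib_left)
qed

theorem mainTheorem2:
  shows "(\<forall>x a b c'. first_kind x a b c' \<noteq> (\<lambda>v. 0) \<longrightarrow>
            first_kind x a b c' \<approx> d_star \<or> first_kind x a b c' \<approx> d_sharp \<or>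
            (\<exists>c. first_kind x a b c' \<approx> d_c c))
       \<and> \<not> d_star \<approx> d_sharp
       \<and> (\<forall>c. \<not> d_star \<approx> d_c c)
       \<and> (\<forall>c. \<not> d_sharp \<approx> d_c c)
       \<and> (\<forall>c c'. c \<noteq> c' \<longrightarrow> (d_c c \<approx> d_c c' \<longleftrightarrow> c * c' = 1))
       \<and> (\<forall>c c'. d_c c \<approx> d_c c' \<longleftrightarrow> c' = c \<or> (c \<noteq> 0 \<and> c' = inverse c))"
proof (intro conjI allI impI)
  \<comment> \<open>The trace and determinant of \<open>d_star\<close> are 0 and stay 0 under
    scaling, but \<open>d_sharp\<close> has trace 2, and \<open>1 + c\<close> and \<open>c\<close>
    cannot both vanish.\<close>
  show "\<not> d_star \<approx> d_sharp"
    unfolding canonical_first_kind by (auto elim!: first_kind_equivalent_invariants)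
  show "\<not> d_star \<approx> d_c c" for c
    unfolding canonical_first_kind by (auto elim!: first_kind_equivalent_invariants)
  show "d_c c \<approx> d_c c' \<longleftrightarrow> c * c' = 1" if "c \<noteq> c'" for c c'
    using that inverse_unique[of c c'] unfolding d_c_equivalent_iff by auto
qed (rule first_kind_normal_form not_d_sharp_equivalent_d_c d_c_equivalent_iff, assumption?)+

end
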